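(* For each $N\in\mathbb N$ and $z\in\mathbb C^+$, the equation $M(-z-\Xi(M))=I$ has a unique solution $M$ in $\mathcal M_N^+$, and this solution lies in $\mathcal M_N\big(\eta(2K\eta^{-1}+|z|)^{-2},\,4\eta^{-1}\big)$, where $\eta=\Im z$.
   Context: $K\ge1$ integer. For each $N$, $(x_{ij})_{1\le i\le j\le N}$ are real centered random variables with $x_{ij}$ independent of $(x_{kl})_{|i-k|\vee|j-l|>K}$ and $\operatorname{Var}(x_{ij})\le1$; $\xi_{ijkl}=\mathbb E[x_{ij}x_{kl}]$ if $i\le j,k\le l$; $\xi_{ijkl}=\xi_{jilk}$ if $i>j,k>l$; $\xi_{ijkl}=0$ otherwise. $(\Xi(M))_{ik}:=\frac1N\sum_{j,l=1}^N\xi_{ijkl}M_{jl}$. $\|\cdot\|$ is the operator norm. $\mathcal M_N^+=\{M\in\mathbb C^{N\times N}:\frac1{2i}(M-M^* )>0\}$; for $\varepsilon,\delta\ge0$, $\mathcal M_N(\varepsilon,\delta)=\{M:\frac1{2i}(M-M^* )>\varepsilon,\ \|M\|<\delta\}$. *)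

theory Defs
  imports "HOL-Probability.Probability"
begin

text \<open>N x N complex matrices are represented as functions nat => nat => complex
  vanishing outside the index range 0..N-1 (0-based indices; the paper uses 1..N).\<close>

definition sq_mat :: "nat \<Rightarrow> (nat \<Rightarrow> nat \<Rightarrow> complex) \<Rightarrow> bool" where
  "sq_mat N M \<longleftrightarrow> (\<forall>i j. (N \<le> i \<or> N \<le> j) \<longrightarrow> M i j = 0)"

definition mmul :: "nat \<Rightarrow> (nat \<Rightarrow> nat \<Rightarrow> complex) \<Rightarrow> (nat \<Rightarrow> nat \<Rightarrow> complex) \<Rightarrow> nat \<Rightarrow> nat \<Rightarrow> complex" where
  "mmul N A B = (\<lambda>i k. \<Sum>j<N. A i j * B j k)"

definition idm :: "nat \<Rightarrow> nat \<Rightarrow> nat \<Rightarrow> complex" where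
  "idm N = (\<lambda>i k. if i = k \<and> i < N then 1 else 0)"

definition imag_part :: "(nat \<Rightarrow> nat \<Rightarrow> complex) \<Rightarrow> nat \<Rightarrow> nat \<Rightarrow> complex" where
  "imag_part M = (\<lambda>i j. (M i j - cnj (M j i)) / (2 * \<i>))"

definition mat_gt :: "nat \<Rightarrow> (nat \<Rightarrow> nat \<Rightarrow> complex) \<Rightarrow> real \<Rightarrow> bool" where
  "mat_gt N H eps \<longleftrightarrow> (\<forall>v::nat \<Rightarrow> complex. (\<exists>i<N. v i \<noteq> 0) \<longrightarrow>
      Re (\<Sum>i<N. \<Sum>j<N. cnj (v i) * (H i j - (if i = j then complex_of_real eps else 0)) * v j) > 0)"

definition opnorm :: "nat \<Rightarrow> (nat \<Rightarrow> nat \<Rightarrow> complex) \<Rightarrow> real" where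
  "opnorm N M = Sup {sqrt (\<Sum>i<N. (cmod (\<Sum>j<N. M i j * v j))\<^sup>2) | v :: nat \<Rightarrow> complex.
                       (\<Sum>j<N. (cmod (v j))\<^sup>2) \<le> 1}"

definition Mplus :: "nat \<Rightarrow> (nat \<Rightarrow> nat \<Rightarrow> complex) set" where
  "Mplus N = {M. sq_mat N M \<and> mat_gt N (imag_part M) 0}"

definition Meps :: "nat \<Rightarrow> real \<Rightarrow> real \<Rightarrow> (nat \<Rightarrow> nat \<Rightarrow> complex) set" where
  "Meps N eps delta = {M. sq_mat N M \<and> mat_gt N (imag_part M) eps \<and> opnorm N M < delta}"

definition xi :: "'a measure \<Rightarrow> (nat \<Rightarrow> nat \<Rightarrow> 'a \<Rightarrow> real) \<Rightarrow> nat \<Rightarrow> nat \<Rightarrow> nat \<Rightarrow> nat \<Rightarrow> real" where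
  "xi P x i j k l =
     (if i \<le> j \<and> k \<le> l then integral\<^sup>L P (\<lambda>\<omega>. x i j \<omega> * x k l \<omega>)
      else if j < i \<and> l < k then integral\<^sup>L P (\<lambda>\<omega>. x j i \<omega> * x l k \<omega>)
      else 0)"

definition Xi :: "'a measure \<Rightarrow> (nat \<Rightarrow> nat \<Rightarrow> 'a \<Rightarrow> real) \<Rightarrow> nat \<Rightarrow> (nat \<Rightarrow> nat \<Rightarrow> complex) \<Rightarrow> nat \<Rightarrow> nat \<Rightarrow> complex" where
  "Xi P x N M = (\<lambda>i k. if i < N \<and> k < N then
       (1 / of_nat N) * (\<Sum>j<N. \<Sum>l<N. complex_of_real (xi P x i j k l) * M j l) else 0)"

definition idist :: "nat \<Rightarrow> nat \<Rightarrow> nat \<Rightarrow> nat \<Rightarrow> nat" where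
  "idist i j k l = max (nat \<bar>int i - int k\<bar>) (nat \<bar>int j - int l\<bar>)"

end

theory Submission
  imports Defs "Jordan_Normal_Form.Determinant"
begin

text \<open>
  The map M to (-z - Xi(M))^-1 is iterated; Im M[u] below denotes the quadratic form of the
  imaginary part, Im <u, M u>.  Distances between M and M' are measured by the least c with
  2 |<u, (M - M') v>| <= c (Im M[u] + Im M'[v]) for all u and v.  Since Xi is an average of
  congruences M to A M A^T with real A, it preserves such inequalities.  For G = (-z - Xi(M))^-1 and
  w = G v or w = G^* v one has Im G[v] = Im z |w|^2 + Im Xi(M)[w], and the first term is at least a
  fixed fraction of the whole.  Together with the resolvent identity this makes the map a strict
  contraction, which gives both uniqueness and convergence of the iterates.

  The lower bound on Im M needs |Xi(M)| <= 2 K |M|.  By positivity it suffices to bound Xi(I), an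
  average of covariance matrices of columns with dependence range K, whose norm is at most
  K + 1 <= 2 K.  The inequality is strict even for K = 1: if Im Xi(M)[w] = 0, then Xi(M) w = 0.
\<close>

section \<open>Sesquilinear forms and matrix inverses\<close>

text \<open>Vectors are arbitrary functions on the naturals of which only the values below
  \<open>N\<close> count, so equations between vectors are stated for \<open>i < N\<close> and
  carried into forms and norms by \<open>cinner_cong\<close> and \<open>vnorm_cong\<close>.\<close>

definition mvec :: "nat \<Rightarrow> (nat \<Rightarrow> nat \<Rightarrow> complex) \<Rightarrow> (nat \<Rightarrow> complex) \<Rightarrow> nat \<Rightarrow> complex" where
  "mvec N M v = (\<lambda>i. \<Sum>j<N. M i j * v j)"

definition madj :: "(nat \<Rightarrow> nat \<Rightarrow> complex) \<Rightarrow> nat \<Rightarrow> nat \<Rightarrow> complex" where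
  "madj M = (\<lambda>i j. cnj (M j i))"

definition cinner :: "nat \<Rightarrow> (nat \<Rightarrow> complex) \<Rightarrow> (nat \<Rightarrow> complex) \<Rightarrow> complex" where
  "cinner N u v = (\<Sum>i<N. cnj (u i) * v i)"

definition vnorm :: "nat \<Rightarrow> (nat \<Rightarrow> complex) \<Rightarrow> real" where
  "vnorm N u = L2_set (\<lambda>i. cmod (u i)) {..<N}"

definition sform :: "nat \<Rightarrow> (nat \<Rightarrow> nat \<Rightarrow> complex) \<Rightarrow> (nat \<Rightarrow> complex) \<Rightarrow> (nat \<Rightarrow> complex) \<Rightarrow> complex" where
  "sform N M u v = (\<Sum>i<N. \<Sum>j<N. cnj (u i) * M i j * v j)"

lemma sform_mvec: "sform N M u v = cinner N u (mvec N M v)"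
  by (simp add: sform_def cinner_def mvec_def sum_distrib_left mult.assoc)

lemma sform_madj: "sform N M u v = cinner N (mvec N (madj M) u) v"
  unfolding sform_def cinner_def mvec_def madj_def
  by (subst sum.swap) (simp add: sum_distrib_right sum_distrib_left mult_ac)

lemma cinner_commute: "cinner N u v = cnj (cinner N v u)"
  by (simp add: cinner_def mult_ac)

lemma cinner_cong:
  "(\<And>i. i < N \<Longrightarrow> u i = u' i) \<Longrightarrow> (\<And>i. i < N \<Longrightarrow> v i = v' i) \<Longrightarrow> cinner N u v = cinner N u' v'"
  by (simp add: cinner_def)

lemma vnorm_cong: "(\<And>i. i < N \<Longrightarrow> u i = u' i) \<Longrightarrow> vnorm N u = vnorm N u'"
  unfolding vnorm_def by (rule L2_set_cong) auto

lemma vnorm_nonneg [simp]: "vnorm N u \<ge> 0"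
  by (simp add: vnorm_def)

lemma vnorm_sq: "(vnorm N u)\<^sup>2 = (\<Sum>i<N. (cmod (u i))\<^sup>2)"
  by (simp add: vnorm_def L2_set_def sum_nonneg)

lemma vnorm_eq_0_iff: "vnorm N u = 0 \<longleftrightarrow> (\<forall>i<N. u i = 0)"
  by (simp add: vnorm_def L2_set_eq_0_iff Ball_def)

lemma vnorm_pos_iff: "vnorm N u > 0 \<longleftrightarrow> (\<exists>i<N. u i \<noteq> 0)"
  using vnorm_eq_0_iff[of N u] vnorm_nonneg[of N u] by (smt (verit))

lemma vnorm_add_le: "vnorm N (\<lambda>i. u i + v i) \<le> vnorm N u + vnorm N v"
proof -
  have "vnorm N (\<lambda>i. u i + v i) \<le> L2_set (\<lambda>i. cmod (u i) + cmod (v i)) {..<N}"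
    unfolding vnorm_def by (intro L2_set_mono norm_triangle_ineq norm_ge_zero)
  also have "\<dots> \<le> vnorm N u + vnorm N v"
    unfolding vnorm_def by (rule L2_set_triangle_ineq)
  finally show ?thesis .
qed

lemma vnorm_scale: "vnorm N (\<lambda>i. c * u i) = cmod c * vnorm N u"
  by (simp add: vnorm_def L2_set_right_distrib norm_mult)

lemma cinner_self: "cinner N u u = complex_of_real ((vnorm N u)\<^sup>2)"
  unfolding vnorm_sq cinner_def by (simp add: complex_norm_square mult.commute flip: of_real_power)

lemma cmod_cinner_le: "cmod (cinner N u v) \<le> vnorm N u * vnorm N v"
proof -
  have "cmod (cinner N u v) \<le> (\<Sum>i<N. \<bar>cmod (u i)\<bar> * \<bar>cmod (v i)\<bar>)"
    unfolding cinner_def by (rule order_trans[OF norm_sum]) (simp add: norm_mult)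
  also have "\<dots> \<le> vnorm N u * vnorm N v"
    unfolding vnorm_def by (rule L2_set_mult_ineq)
  finally show ?thesis .
qed

lemma sform_diff: "sform N (\<lambda>i j. A i j - B i j) u v = sform N A u v - sform N B u v"
  by (simp add: sform_def algebra_simps sum_subtractf)

lemma sform_idm: "sform N (\<lambda>i j. c * idm N i j) u v = c * cinner N u v"
proof -
  have "sform N (\<lambda>i j. c * idm N i j) u v
      = (\<Sum>i<N. \<Sum>j<N. if j = i then c * (cnj (u i) * v i) else 0)"
    unfolding sform_def idm_def by (intro sum.cong refl) auto
  also have "\<dots> = c * cinner N u v"
    by (simp add: cinner_def sum_distrib_left)
  finally show ?thesis .
qed

lemma sform_scale_right: "sform N A u (\<lambda>i. c * v i) = c * sform N A u v"
  by (simp add: sform_def sum_distrib_left mult_ac)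

lemma sform_scale_left: "sform N A (\<lambda>i. c * u i) v = cnj c * sform N A u v"
  by (simp add: sform_def sum_distrib_left mult_ac)

lemma sform_cong:
  "(\<And>i j. i < N \<Longrightarrow> j < N \<Longrightarrow> A i j = B i j) \<Longrightarrow> sform N A u v = sform N B u v"
  by (simp add: sform_def)

lemma sform_unit:
  assumes "i < N" "j < N"
  shows "sform N M (\<lambda>k. if k = i then 1 else 0) (\<lambda>k. if k = j then 1 else 0) = M i j"
proof -
  have "sform N M (\<lambda>k. if k = i then 1 else 0) (\<lambda>k. if k = j then 1 else 0)
      = (\<Sum>i'<N. \<Sum>j'<N. if j' = j then (if i' = i then M i j else 0) else 0)"
    unfolding sform_def by (intro sum.cong refl) auto
  with assms show ?thesis by simp
qed

lemma vnorm_unit: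
  assumes "i < N"
  shows "vnorm N (\<lambda>k. if k = i then 1 else 0) = 1"
proof -
  have "(vnorm N (\<lambda>k. if k = i then 1 else 0))\<^sup>2 = (\<Sum>k<N. if k = i then 1 else 0)"
    unfolding vnorm_sq by (intro sum.cong) auto
  also have "\<dots> = 1" using assms by simp
  finally show ?thesis by (simp add: power2_eq_1_iff) (use vnorm_nonneg[of N] in \<open>smt (verit)\<close>)
qed

section \<open>Products, adjoints and inverses of matrices\<close>

lemma mvec_mmul: "mvec N (mmul N A B) v = mvec N A (mvec N B v)"
  unfolding mvec_def mmul_def
  by (rule ext) (simp add: sum_distrib_left sum_distrib_right mult.assoc, rule sum.swap)

lemma mvec_idm: "i < N \<Longrightarrow> mvec N (idm N) v i = v i"
proof -
  assume "i < N"
  have "mvec N (idm N) v i = (\<Sum>j<N. if j = i then v i else 0)"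
    unfolding mvec_def idm_def using \<open>i < N\<close> by (intro sum.cong) auto
  with \<open>i < N\<close> show ?thesis by simp
qed

lemma madj_mmul: "madj (mmul N A B) = mmul N (madj B) (madj A)"
  by (simp add: madj_def mmul_def mult.commute)

lemma madj_idm: "madj (idm N) = idm N"
  by (auto simp: madj_def idm_def fun_eq_iff)

lemma mmul_assoc: "mmul N (mmul N A B) C = mmul N A (mmul N B C)"
  unfolding mmul_def
  by (intro ext) (simp add: sum_distrib_left sum_distrib_right mult.assoc, rule sum.swap)

lemma mmul_idm_right: "sq_mat N A \<Longrightarrow> mmul N A (idm N) = A"
proof (intro ext)
  fix i k assume A: "sq_mat N A"
  have "mmul N A (idm N) i k = (\<Sum>j<N. if j = k then A i k else 0)"
    unfolding mmul_def idm_def by (intro sum.cong) auto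
  then show "mmul N A (idm N) i k = A i k"
    using A by (auto simp: sq_mat_def)
qed

lemma mmul_idm_left: "sq_mat N A \<Longrightarrow> mmul N (idm N) A = A"
proof (intro ext)
  fix i k assume A: "sq_mat N A"
  have "mmul N (idm N) A i k = (\<Sum>j<N. if j = i then A i k else 0)"
    unfolding mmul_def idm_def by (intro sum.cong) auto
  then show "mmul N (idm N) A i k = A i k"
    using A by (auto simp: sq_mat_def)
qed

text \<open>A trivial kernel forces a nonzero determinant, which yields a two-sided inverse.
  \<open>sq_mat N B\<close> makes the products agree with \<open>idm N\<close> outside the index
  range as well.\<close>

lemma injective_imp_inverse:
  assumes B: "sq_mat N B"
    and inj: "\<And>v. (\<And>i. i < N \<Longrightarrow> mvec N B v i = 0) \<Longrightarrow> (\<And>i. i < N \<Longrightarrow> v i = 0)"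
  obtains G where "sq_mat N G" "mmul N G B = idm N" "mmul N B G = idm N"
proof -
  let ?B = "mat N N (\<lambda>(i, j). B i j)"
  have cB: "?B \<in> carrier_mat N N" by simp
  have "det ?B \<noteq> 0"
  proof
    assume "det ?B = 0"
    then obtain w where w: "w \<in> carrier_vec N" "w \<noteq> 0\<^sub>v N" "?B *\<^sub>v w = 0\<^sub>v N"
      using det_0_iff_vec_prod_zero[OF cB] by blast
    have "mvec N B (vec_index w) i = 0" if "i < N" for i
    proof -
      have "mvec N B (vec_index w) i = (?B *\<^sub>v w) $ i"
        using that w(1) by (simp add: mvec_def scalar_prod_def atLeast0LessThan)
      with w(3) that show ?thesis by simp
    qed
    then have "w $ i = 0" if "i < N" for i using inj[of "vec_index w"] that by blast
    then have "w = 0\<^sub>v N" using w(1) by (intro eq_vecI) auto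
    with w(2) show False by blast
  qed
  \<comment> \<open>\<open>()\<close> is an arbitrary filler for the record extension of
    \<open>ring_mat\<close>.\<close>
  from det_non_zero_imp_unit[OF cB this, of "()"]
  obtain C where C: "C \<in> carrier_mat N N" "C * ?B = 1\<^sub>m N" "?B * C = 1\<^sub>m N"
    unfolding Units_def ring_mat_def by auto
  define G where "G = (\<lambda>i j. if i < N \<and> j < N then C $$ (i, j) else 0)"
  have sq: "sq_mat N G" by (auto simp: sq_mat_def G_def)
  have "mmul N G B i j = idm N i j" for i j
  proof (cases "i < N \<and> j < N")
    case True
    then have "mmul N G B i j = (C * ?B) $$ (i, j)"
      using C(1) by (simp add: mmul_def G_def scalar_prod_def atLeast0LessThan)
    with True show ?thesis by (simp add: C(2) idm_def)
  next
    case False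
    then show ?thesis using B by (auto simp: mmul_def idm_def G_def sq_mat_def)
  qed
  moreover have "mmul N B G i j = idm N i j" for i j
  proof (cases "i < N \<and> j < N")
    case True
    then have "mmul N B G i j = (?B * C) $$ (i, j)"
      using C(1) by (simp add: mmul_def G_def scalar_prod_def atLeast0LessThan)
    with True show ?thesis by (simp add: C(3) idm_def)
  next
    case False
    then show ?thesis using B by (auto simp: mmul_def idm_def G_def sq_mat_def)
  qed
  ultimately show ?thesis using that sq by blast
qed

text \<open>The adjoint of \<open>M\<close> has the conjugate form at \<open>v\<close>, so the form
  of \<open>imag_part M\<close> is \<open>Im (sform N M v v)\<close>. This turns
  \<open>mat_gt\<close> into an inequality between forms.\<close>

lemma Re_form_imag_part:
  "Re (\<Sum>i<N. \<Sum>j<N. cnj (v i) * (imag_part M i j - (if i = j then complex_of_real eps else 0)) * v j)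
   = Im (sform N M v v) - eps * (vnorm N v)\<^sup>2"
proof -
  have "(\<Sum>i<N. \<Sum>j<N. cnj (v i) * (imag_part M i j - (if i = j then complex_of_real eps else 0)) * v j)
     = sform N (imag_part M) v v - sform N (\<lambda>i j. of_real eps * idm N i j) v v"
    unfolding sform_diff[symmetric] unfolding sform_def idm_def by (intro sum.cong refl) auto
  moreover have "sform N (imag_part M) v v = (sform N M v v - sform N (madj M) v v) / (2 * \<i>)"
    unfolding sform_diff[symmetric] unfolding sform_def imag_part_def madj_def
    by (simp add: sum_divide_distrib sum_distrib_left sum_negf mult_ac)
  moreover have "sform N (madj M) v v = cnj (sform N M v v)"
    unfolding sform_madj[of N M] by (simp add: sform_mvec cinner_commute[of N v])
  moreover have "(c - cnj c) / (2 * \<i>) = of_real (Im c)" for c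
    by (simp add: complex_eq_iff)
  ultimately show ?thesis by (simp add: sform_idm cinner_self)
qed

lemma mat_gt_imag_part_iff:
  "mat_gt N (imag_part M) eps \<longleftrightarrow> (\<forall>v. vnorm N v > 0 \<longrightarrow> Im (sform N M v v) > eps * (vnorm N v)\<^sup>2)"
  unfolding mat_gt_def Re_form_imag_part vnorm_pos_iff by simp

lemma opnorm_le:
  assumes "m \<ge> 0" "\<And>v. vnorm N (mvec N M v) \<le> m * vnorm N v"
  shows "opnorm N M \<le> m"
  unfolding opnorm_def
proof (rule cSup_least)
  show "{sqrt (\<Sum>i<N. (cmod (\<Sum>j<N. M i j * v j))\<^sup>2) | v. (\<Sum>j<N. (cmod (v j))\<^sup>2) \<le> 1} \<noteq> {}"
    by (auto intro!: exI[of _ "\<lambda>_. 0"])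
next
  fix s assume "s \<in> {sqrt (\<Sum>i<N. (cmod (\<Sum>j<N. M i j * v j))\<^sup>2) | v. (\<Sum>j<N. (cmod (v j))\<^sup>2) \<le> 1}"
  then obtain v where s: "s = vnorm N (mvec N M v)" and "(vnorm N v)\<^sup>2 \<le> 1"
    unfolding vnorm_sq by (auto simp: vnorm_def mvec_def L2_set_def)
  then have "vnorm N v \<le> 1"
    using power2_le_imp_le[of "vnorm N v" 1] by simp
  then have "m * vnorm N v \<le> m" using \<open>m \<ge> 0\<close> by (simp add: mult_left_le)
  with assms(2)[of v] s show "s \<le> m" by simp
qed

section \<open>Resolvents\<close>

text \<open>The sum of the squares is twice the product when \<open>u\<close> and \<open>v\<close>
  have equal norm, so testing with the multiple of \<open>A v\<close> that has the norm of
  \<open>v\<close> loses nothing.\<close>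

lemma vnorm_mvec_le:
  assumes "\<And>u v. 2 * cmod (sform N A u v) \<le> b * ((vnorm N u)\<^sup>2 + (vnorm N v)\<^sup>2)"
  shows "vnorm N (mvec N A v) \<le> b * vnorm N v"
proof (cases "vnorm N v = 0 \<or> vnorm N (mvec N A v) = 0")
  case True
  then show ?thesis
  proof
    assume "vnorm N v = 0"
    then have "mvec N A v i = 0" for i by (simp add: vnorm_eq_0_iff mvec_def)
    then have "vnorm N (mvec N A v) = 0" by (simp add: vnorm_eq_0_iff)
    with \<open>vnorm N v = 0\<close> show ?thesis by simp
  next
    assume w: "vnorm N (mvec N A v) = 0"
    show ?thesis
    proof (cases "vnorm N v = 0")
      case False
      \<comment> \<open>The sign of \<open>b\<close> is not assumed; testing with
        \<open>u = 0\<close> gives it.\<close>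
      have "0 \<le> b * (vnorm N v)\<^sup>2"
        using assms[of "\<lambda>_. 0" v] order_trans[of 0 "2 * cmod (sform N A (\<lambda>_. 0) v)"]
        by (simp add: sform_def vnorm_def L2_set_0')
      with False have "0 \<le> b" by (simp add: zero_le_mult_iff)
      with w show ?thesis by simp
    qed (simp add: w)
  qed
next
  case False
  define p where "p = vnorm N v"
  define w where "w = mvec N A v"
  define q where "q = vnorm N w"
  have pq: "p > 0" "q > 0"
    using False by (auto simp: p_def q_def w_def less_le)
  let ?u = "\<lambda>i. complex_of_real (p / q) * w i"
  have "sform N A ?u v = complex_of_real (p / q * q\<^sup>2)"
    unfolding sform_scale_left by (simp add: sform_mvec cinner_self q_def flip: w_def)
  then have "cmod (sform N A ?u v) = p * q"
    using pq by (simp add: norm_mult norm_divide power2_eq_square)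
  moreover have "vnorm N ?u = p"
    unfolding vnorm_scale using pq by (simp add: norm_divide flip: q_def)
  ultimately have "p * (2 * q) \<le> p * (2 * (b * p))"
    using assms[of ?u v] by (simp add: p_def[symmetric] power2_eq_square algebra_simps)
  with pq(1) have "q \<le> b * p" by simp
  then show ?thesis by (simp add: p_def q_def w_def)
qed

text \<open>With w the image of v under the adjoint, |w|^2 = <v, A w> <= b |v| |w|, and one factor
  |w| cancels.\<close>

lemma vnorm_mvec_madj_le:
  assumes "\<And>v. vnorm N (mvec N A v) \<le> b * vnorm N v"
  shows "vnorm N (mvec N (madj A) v) \<le> b * vnorm N v"
proof (cases "vnorm N (mvec N (madj A) v) = 0")
  case True
  have "0 \<le> b * vnorm N v" using assms[of v] vnorm_nonneg order_trans by blast
  with True show ?thesis by simp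
next
  case False
  define w where "w = mvec N (madj A) v"
  have "complex_of_real ((vnorm N w)\<^sup>2) = sform N A v w"
    by (simp add: sform_madj cinner_self flip: w_def)
  then have "(vnorm N w)\<^sup>2 = cmod (cinner N v (mvec N A w))"
    by (metis sform_mvec norm_of_real abs_of_nonneg zero_le_power2)
  also have "\<dots> \<le> vnorm N v * vnorm N (mvec N A w)" by (rule cmod_cinner_le)
  also have "\<dots> \<le> vnorm N v * (b * vnorm N w)" by (intro mult_left_mono assms) simp
  finally have "vnorm N w * vnorm N w \<le> vnorm N w * (b * vnorm N v)"
    by (simp add: power2_eq_square mult_ac)
  moreover have "vnorm N w > 0" using False by (simp add: w_def less_le)
  ultimately show ?thesis by (simp add: w_def)
qed

lemma cmod_sform_le:
  assumes "\<And>v. vnorm N (mvec N A v) \<le> m * vnorm N v"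
  shows "cmod (sform N A u v) \<le> m * (vnorm N u * vnorm N v)"
proof -
  have "cmod (sform N A u v) \<le> vnorm N u * vnorm N (mvec N A v)"
    unfolding sform_mvec by (rule cmod_cinner_le)
  also have "\<dots> \<le> vnorm N u * (m * vnorm N v)" by (intro mult_left_mono assms) simp
  finally show ?thesis by (simp add: mult_ac)
qed

text \<open>The body is literally the second factor in the final theorem, so unfolding identifies
  the two.\<close>

definition shifted :: "nat \<Rightarrow> complex \<Rightarrow> (nat \<Rightarrow> nat \<Rightarrow> complex) \<Rightarrow> nat \<Rightarrow> nat \<Rightarrow> complex" where
  "shifted N z Y = (\<lambda>i k. - z * idm N i k - Y i k)"

text \<open>Both products are recorded: the right inverse is used through G, the left inverse
  through the adjoint of G.\<close>

definition resolvent_of :: "nat \<Rightarrow> complex \<Rightarrow> (nat \<Rightarrow> nat \<Rightarrow> complex) \<Rightarrow> (nat \<Rightarrow> nat \<Rightarrow> complex) \<Rightarrow> bool" where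
  "resolvent_of N z Y G \<longleftrightarrow>
     sq_mat N G \<and> mmul N G (shifted N z Y) = idm N \<and> mmul N (shifted N z Y) G = idm N"

lemma sform_shifted: "sform N (shifted N z Y) u v = - z * cinner N u v - sform N Y u v"
  unfolding shifted_def sform_diff sform_idm ..

lemma resolvent_of_right:
  assumes "resolvent_of N z Y G" "i < N"
  shows "mvec N (shifted N z Y) (mvec N G v) i = v i"
  using assms by (simp add: resolvent_of_def mvec_idm flip: mvec_mmul)

lemma resolvent_of_left:
  assumes "resolvent_of N z Y G" "i < N"
  shows "mvec N (madj (shifted N z Y)) (mvec N (madj G) v) i = v i"
  using assms by (simp add: resolvent_of_def mvec_idm madj_idm flip: mvec_mmul madj_mmul)

text \<open>In matrix terms Im G = G^* (Im z + Im Y) G, because v = (-z - Y) w for w = G v.\<close>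

lemma Im_sform_resolvent_right:
  assumes "resolvent_of N z Y G"
  shows "Im (sform N G v v) = Im z * (vnorm N (mvec N G v))\<^sup>2 + Im (sform N Y (mvec N G v) (mvec N G v))"
proof -
  let ?w = "mvec N G v"
  have "sform N G v v = cinner N (mvec N (shifted N z Y) ?w) ?w"
    unfolding sform_mvec using resolvent_of_right[OF assms] by (intro cinner_cong) auto
  also have "\<dots> = cnj (sform N (shifted N z Y) ?w ?w)"
    unfolding sform_mvec by (rule cinner_commute)
  finally show ?thesis by (simp add: sform_shifted cinner_self)
qed

text \<open>The companion Im G = G (Im z + Im Y) G^*, needed because
  \<open>resolvent_identity\<close> applies an adjoint to the left vector.\<close>

lemma Im_sform_resolvent_left:
  assumes "resolvent_of N z Y G"
  shows "Im (sform N G v v)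
    = Im z * (vnorm N (mvec N (madj G) v))\<^sup>2 + Im (sform N Y (mvec N (madj G) v) (mvec N (madj G) v))"
proof -
  let ?w = "mvec N (madj G) v"
  have "sform N G v v = cinner N ?w (mvec N (madj (shifted N z Y)) ?w)"
    unfolding sform_madj using resolvent_of_left[OF assms] by (intro cinner_cong) auto
  also have "\<dots> = cnj (sform N (shifted N z Y) ?w ?w)"
    unfolding sform_madj by (rule cinner_commute)
  finally show ?thesis by (simp add: sform_shifted cinner_self)
qed

text \<open>This is G1 - G2 = G1 (Y1 - Y2) G2 with G1 moved to the left vector.\<close>

lemma resolvent_identity:
  assumes G1: "resolvent_of N z Y1 G1" and G2: "resolvent_of N z Y2 G2"
  shows "sform N (\<lambda>i j. G1 i j - G2 i j) u v
    = sform N (\<lambda>i j. Y1 i j - Y2 i j) (mvec N (madj G1) u) (mvec N G2 v)"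
proof -
  let ?u = "mvec N (madj G1) u" and ?v = "mvec N G2 v"
  have "sform N G1 u v = cinner N ?u (mvec N (shifted N z Y2) ?v)"
    unfolding sform_madj using resolvent_of_right[OF G2] by (intro cinner_cong) auto
  moreover have "sform N G2 u v = cinner N (mvec N (madj (shifted N z Y1)) ?u) ?v"
    unfolding sform_mvec using resolvent_of_left[OF G1] by (intro cinner_cong) auto
  ultimately have "sform N G1 u v - sform N G2 u v
      = sform N (shifted N z Y2) ?u ?v - sform N (shifted N z Y1) ?u ?v"
    by (simp add: sform_mvec[of N "shifted N z Y2"] sform_madj[of N "shifted N z Y1"])
  then show ?thesis by (simp add: sform_diff sform_shifted)
qed

text \<open>On a kernel vector v of -z - Y, the nonnegative terms Im z |v|^2 and Im Y[v] add up to
  0, so v vanishes.\<close>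

lemma resolvent_exists:
  assumes "Im z > 0" "sq_mat N Y" "\<And>u. 0 \<le> Im (sform N Y u u)"
  obtains G where "resolvent_of N z Y G"
proof -
  have "sq_mat N (shifted N z Y)"
    using assms(2) by (auto simp: sq_mat_def shifted_def idm_def)
  moreover have "v i = 0"
    if v: "\<And>i. i < N \<Longrightarrow> mvec N (shifted N z Y) v i = 0" and "i < N" for v i
  proof -
    have "cinner N v (mvec N (shifted N z Y) v) = 0"
      using v by (simp add: cinner_def)
    then have "Im (sform N (shifted N z Y) v v) = 0" by (simp add: sform_mvec)
    then have "Im z * (vnorm N v)\<^sup>2 + Im (sform N Y v v) = 0"
      by (simp add: sform_shifted cinner_self)
    with assms(1) assms(3)[of v] have "Im z * (vnorm N v)\<^sup>2 = 0"
      by (smt (verit) mult_nonneg_nonneg zero_le_power2)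
    with assms(1) have "vnorm N v = 0" by simp
    with \<open>i < N\<close> show ?thesis by (simp add: vnorm_eq_0_iff)
  qed
  ultimately obtain G where "sq_mat N G" "mmul N G (shifted N z Y) = idm N" "mmul N (shifted N z Y) G = idm N"
    using injective_imp_inverse by metis
  then show ?thesis using that by (simp add: resolvent_of_def)
qed

text \<open>With w = G v, Im z |w|^2 <= Im <v, G v> <= |v| |w|, and one factor |w| cancels.\<close>

lemma vnorm_resolvent_le:
  assumes "Im z > 0" "\<And>u. 0 \<le> Im (sform N Y u u)" "resolvent_of N z Y G"
  shows "vnorm N (mvec N G v) \<le> 1 / Im z * vnorm N v"
proof (cases "vnorm N (mvec N G v) = 0")
  case False
  let ?w = "mvec N G v"
  have "Im z * (vnorm N ?w)\<^sup>2 \<le> Im (sform N G v v)"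
    using Im_sform_resolvent_right[OF assms(3), of v] assms(2)[of ?w] by simp
  also have "\<dots> \<le> cmod (sform N G v v)"
    using abs_Im_le_cmod[of "sform N G v v"] by simp
  also have "\<dots> \<le> vnorm N v * vnorm N ?w"
    unfolding sform_mvec by (rule cmod_cinner_le)
  finally have "vnorm N ?w * (Im z * vnorm N ?w) \<le> vnorm N ?w * vnorm N v"
    by (simp add: power2_eq_square mult_ac)
  moreover have "vnorm N ?w > 0" using False vnorm_nonneg[of N ?w] by linarith
  ultimately have "Im z * vnorm N ?w \<le> vnorm N v" by simp
  with assms(1) show ?thesis by (simp add: field_simps)
qed (use assms(1) in simp)

lemma vnorm_shifted_le:
  assumes "\<And>v. vnorm N (mvec N Y v) \<le> y * vnorm N v"
  shows "vnorm N (mvec N (shifted N z Y) v) \<le> (cmod z + y) * vnorm N v"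
proof -
  have "mvec N (shifted N z Y) v i = (- z) * v i + (- 1) * mvec N Y v i" if "i < N" for i
  proof -
    have "mvec N (shifted N z Y) v i = - z * mvec N (idm N) v i - mvec N Y v i"
      by (simp add: mvec_def shifted_def algebra_simps sum_subtractf sum_negf sum_distrib_left)
    with that show ?thesis by (simp add: mvec_idm)
  qed
  then have "vnorm N (mvec N (shifted N z Y) v)
      = vnorm N (\<lambda>i. (- z) * v i + (- 1) * mvec N Y v i)"
    by (rule vnorm_cong)
  also have "\<dots> \<le> vnorm N (\<lambda>i. (- z) * v i) + vnorm N (\<lambda>i. (- 1) * mvec N Y v i)"
    by (rule vnorm_add_le)
  also have "\<dots> = cmod z * vnorm N v + vnorm N (mvec N Y v)"
    unfolding vnorm_scale by simp
  finally show ?thesis using assms[of v] by (simp add: algebra_simps)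
qed

section \<open>Fixed points of positive maps\<close>

lemma two_mult_le_sq_sum: "2 * (a * b) \<le> a\<^sup>2 + b\<^sup>2" for a b :: real
  using sum_squares_bound[of a b] by (simp add: mult.assoc)

text \<open>The properties of the self-energy map on which the fixed point argument rests.
  \<open>T_dominated\<close> is a form of 2-positivity. \<open>T_unit_le\<close> bounds the image of
  the identity, which carries a factor \<open>\<i>\<close> because all bounds are phrased through
  imaginary parts.\<close>

locale dyson_equation =
  fixes N :: nat and T :: "(nat \<Rightarrow> nat \<Rightarrow> complex) \<Rightarrow> nat \<Rightarrow> nat \<Rightarrow> complex"
    and \<kappa> :: real and z :: complex
  assumes sq_T: "sq_mat N (T M)"
    and T_diff: "T (\<lambda>i j. A i j - B i j) = (\<lambda>i k. T A i k - T B i k)"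
    and T_tendsto: "(\<And>j l. (\<lambda>n. S n j l) \<longlonglongrightarrow> L j l) \<Longrightarrow> (\<lambda>n. T (S n) i k) \<longlonglongrightarrow> T L i k"
    and T_dominated:
      "(\<And>u v. 2 * cmod (sform N X u v) \<le> c * (Im (sform N A u u) + Im (sform N B v v))) \<Longrightarrow>
       2 * cmod (sform N (T X) u v) \<le> c * (Im (sform N (T A) u u) + Im (sform N (T B) v v))"
    and T_unit_le: "Im (sform N (T (\<lambda>i j. \<i> * idm N i j)) u u) \<le> \<kappa> * (vnorm N u)\<^sup>2"
    and kappa_nonneg: "\<kappa> \<ge> 0"
    and Im_z_pos: "Im z > 0"
begin

text \<open>Equivalently, the block matrix with diagonal blocks c Im A and c Im B and off-diagonal
  block X is positive semidefinite.\<close>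

definition dominated where
  "dominated c X A B \<longleftrightarrow> (\<forall>u v. 2 * cmod (sform N X u v) \<le> c * (Im (sform N A u u) + Im (sform N B v v)))"

text \<open>A closed condition that holds for the zero matrix, where the iteration starts, and is
  preserved by the map.\<close>

definition admissible where
  "admissible M \<longleftrightarrow> (\<forall>u. 0 \<le> Im (sform N M u u)) \<and> (\<forall>v. vnorm N (mvec N M v) \<le> 1 / Im z * vnorm N v)"

text \<open>For admissible M with G = (-z - T(M))^-1, \<beta> bounds the norm of -z - T(M),
  \<epsilon> bounds Im G from below, and \<delta> is a fraction of Im G[v] that the term Im z |w|^2
  always exceeds or equals.\<close>

definition \<beta> where "\<beta> = cmod z + \<kappa> / Im z"

definition \<epsilon> where "\<epsilon> = Im z / \<beta>\<^sup>2"

definition \<delta> where "\<delta> = (Im z)\<^sup>2 / \<beta>\<^sup>2"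

lemma beta_pos: "\<beta> > 0"
  using kappa_nonneg Im_z_pos abs_Im_le_cmod[of z]
  unfolding \<beta>_def by (smt (verit) divide_nonneg_pos)

lemma eps_pos: "\<epsilon> > 0"
  using beta_pos Im_z_pos by (simp add: \<epsilon>_def)

lemma delta_pos: "\<delta> > 0"
  using beta_pos Im_z_pos by (simp add: \<delta>_def)

lemma delta_le_1: "\<delta> \<le> 1"
proof -
  have "Im z \<le> \<beta>"
    using kappa_nonneg Im_z_pos abs_Im_le_cmod[of z]
    unfolding \<beta>_def by (smt (verit) divide_nonneg_pos)
  then have "(Im z)\<^sup>2 \<le> \<beta>\<^sup>2" using Im_z_pos by (intro power_mono) auto
  then show ?thesis using beta_pos by (simp add: \<delta>_def)
qed

text \<open>Nonnegativity of Im A says that the zero matrix is dominated by A and A;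
  \<open>T_dominated\<close> carries this over to T(A).\<close>

lemma T_pos:
  assumes "\<And>u. 0 \<le> Im (sform N A u u)"
  shows "0 \<le> Im (sform N (T A) u u)"
proof -
  have "2 * cmod (sform N (T (\<lambda>_ _. 0)) u u) \<le> 1 * (Im (sform N (T A) u u) + Im (sform N (T A) u u))"
    by (rule T_dominated) (use assms in \<open>simp add: sform_def add_nonneg_nonneg\<close>)
  then have "0 \<le> 1 * (Im (sform N (T A) u u) + Im (sform N (T A) u u))"
    by (rule order_trans[rotated]) simp
  then show ?thesis by simp
qed

lemma Im_sform_unit: "Im (sform N (\<lambda>i j. \<i> * idm N i j) u u) = (vnorm N u)\<^sup>2"
  by (simp add: sform_idm cinner_self)

text \<open>A positive map is controlled by its value at the identity: by AM-GM, A is dominated by m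
  times the unit, and T preserves the domination.\<close>

lemma vnorm_T_le:
  assumes "m \<ge> 0" and A: "\<And>v. vnorm N (mvec N A v) \<le> m * vnorm N v"
  shows "vnorm N (mvec N (T A) v) \<le> m * \<kappa> * vnorm N v"
proof (rule vnorm_mvec_le)
  fix u v
  have "2 * cmod (sform N A u v) \<le> m * (Im (sform N (\<lambda>i j. \<i> * idm N i j) u u) + Im (sform N (\<lambda>i j. \<i> * idm N i j) v v))" for u v
  proof -
    have "2 * cmod (sform N A u v) \<le> m * (2 * (vnorm N u * vnorm N v))"
      using cmod_sform_le[OF A, of u v] by simp
    also have "\<dots> \<le> m * ((vnorm N u)\<^sup>2 + (vnorm N v)\<^sup>2)"
      by (intro mult_left_mono two_mult_le_sq_sum assms(1))
    finally show ?thesis by (simp only: Im_sform_unit)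
  qed
  then have "2 * cmod (sform N (T A) u v)
      \<le> m * (Im (sform N (T (\<lambda>i j. \<i> * idm N i j)) u u) + Im (sform N (T (\<lambda>i j. \<i> * idm N i j)) v v))"
    by (rule T_dominated)
  also have "\<dots> \<le> m * (\<kappa> * (vnorm N u)\<^sup>2 + \<kappa> * (vnorm N v)\<^sup>2)"
    by (intro mult_left_mono add_mono T_unit_le assms(1))
  finally show "2 * cmod (sform N (T A) u v) \<le> m * \<kappa> * ((vnorm N u)\<^sup>2 + (vnorm N v)\<^sup>2)"
    by (simp add: algebra_simps)
qed

section \<open>Resolvents at admissible matrices\<close>

lemma admissible_shifted_le:
  assumes "admissible M"
  shows "vnorm N (mvec N (shifted N z (T M)) v) \<le> \<beta> * vnorm N v"
proof -
  have "vnorm N (mvec N (T M) v) \<le> \<kappa> / Im z * vnorm N v" for v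
    using vnorm_T_le[of "1 / Im z" M v] assms Im_z_pos by (simp add: admissible_def)
  from vnorm_shifted_le[OF this] show ?thesis by (simp add: \<beta>_def)
qed

lemma admissible_le_right:
  assumes "admissible M" "resolvent_of N z (T M) G"
  shows "vnorm N v \<le> \<beta> * vnorm N (mvec N G v)"
proof -
  have "vnorm N v = vnorm N (mvec N (shifted N z (T M)) (mvec N G v))"
    by (intro vnorm_cong) (simp add: resolvent_of_right[OF assms(2)])
  then show ?thesis using admissible_shifted_le[OF assms(1)] by metis
qed

lemma admissible_le_left:
  assumes "admissible M" "resolvent_of N z (T M) G"
  shows "vnorm N v \<le> \<beta> * vnorm N (mvec N (madj G) v)"
proof -
  have "vnorm N v = vnorm N (mvec N (madj (shifted N z (T M))) (mvec N (madj G) v))"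
    by (intro vnorm_cong) (simp add: resolvent_of_left[OF assms(2)])
  then show ?thesis using vnorm_mvec_madj_le[OF admissible_shifted_le[OF assms(1)]] by metis
qed

lemma admissible_T_pos: "admissible M \<Longrightarrow> 0 \<le> Im (sform N (T M) u u)"
  by (intro T_pos) (simp add: admissible_def)

lemma admissible_resolvent:
  assumes "admissible M" "resolvent_of N z (T M) G"
  shows "admissible G"
  unfolding admissible_def
proof (intro conjI allI)
  fix u
  show "0 \<le> Im (sform N G u u)"
    unfolding Im_sform_resolvent_right[OF assms(2)]
    using admissible_T_pos[OF assms(1)] Im_z_pos by (simp add: add_nonneg_nonneg)
  show "vnorm N (mvec N G u) \<le> 1 / Im z * vnorm N u"
    using vnorm_resolvent_le[OF Im_z_pos admissible_T_pos[OF assms(1)] assms(2)] .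
qed

text \<open>In Im G[v] = Im z |w|^2 + Im T(M)[w] with w = G v, the second term is dropped and |v| <=
  \<beta> |w| is inserted.\<close>

lemma Im_sform_resolvent_ge:
  assumes "admissible M" "resolvent_of N z (T M) G"
  shows "\<epsilon> * (vnorm N v)\<^sup>2 \<le> Im (sform N G v v)"
proof -
  have "(vnorm N v)\<^sup>2 \<le> (\<beta> * vnorm N (mvec N G v))\<^sup>2"
    by (intro power_mono admissible_le_right[OF assms]) simp
  then have "Im z * (vnorm N v)\<^sup>2 \<le> Im z * (\<beta>\<^sup>2 * (vnorm N (mvec N G v))\<^sup>2)"
    using Im_z_pos by (simp add: power_mult_distrib)
  then have "\<epsilon> * (vnorm N v)\<^sup>2 \<le> Im z * (vnorm N (mvec N G v))\<^sup>2"
    using beta_pos by (simp add: \<epsilon>_def field_simps)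
  also have "\<dots> \<le> Im (sform N G v v)"
    unfolding Im_sform_resolvent_right[OF assms(2)] using admissible_T_pos[OF assms(1)] by simp
  finally show ?thesis .
qed

text \<open>Im G[v] <= |v|^2 / Im z <= (\<beta> r)^2 / Im z. The parameter r stands for |w| with
  either w = G v or w = G^* v, so that one bound serves both sides of the resolvent
  identity.\<close>

lemma Im_sform_resolvent_le:
  assumes "admissible M" "resolvent_of N z (T M) G" "vnorm N v \<le> \<beta> * r"
  shows "\<delta> * Im (sform N G v v) \<le> Im z * r\<^sup>2"
proof -
  have "Im (sform N G v v) \<le> cmod (sform N G v v)"
    using abs_Im_le_cmod[of "sform N G v v"] by simp
  also have "\<dots> \<le> 1 / Im z * (vnorm N v * vnorm N v)"
    using admissible_resolvent[OF assms(1,2)] by (intro cmod_sform_le) (simp add: admissible_def)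
  also have "\<dots> \<le> 1 / Im z * ((\<beta> * r) * (\<beta> * r))"
    using Im_z_pos assms(3) order_trans[OF vnorm_nonneg assms(3)] 
    by (intro mult_left_mono mult_mono) auto
  finally have "\<delta> * Im (sform N G v v) \<le> \<delta> * (1 / Im z * ((\<beta> * r) * (\<beta> * r)))"
    using delta_pos by (intro mult_left_mono) auto
  also have "\<dots> = Im z * r\<^sup>2"
    using beta_pos Im_z_pos by (simp add: \<delta>_def field_simps power2_eq_square)
  finally show ?thesis .
qed

text \<open>The resolvent identity reduces the difference to T(M1 - M2) at G1^* u and G2 v, where T
  preserves the domination. Since Im T(M1)[G1^* u] = Im G1[u] - Im z |G1^* u|^2, subtracting the Im
  z term gains the factor 1 - \<delta>; likewise for G2 v.\<close>

lemma dominated_contract: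
  assumes M1: "admissible M1" and M2: "admissible M2"
    and G1: "resolvent_of N z (T M1) G1" and G2: "resolvent_of N z (T M2) G2"
    and c: "c \<ge> 0" "dominated c (\<lambda>i j. M1 i j - M2 i j) M1 M2"
  shows "dominated (c * (1 - \<delta>)) (\<lambda>i j. G1 i j - G2 i j) G1 G2"
  unfolding dominated_def
proof (intro allI)
  fix u v
  let ?u = "mvec N (madj G1) u" and ?v = "mvec N G2 v"
  have "2 * cmod (sform N (\<lambda>i j. G1 i j - G2 i j) u v)
      = 2 * cmod (sform N (T (\<lambda>i j. M1 i j - M2 i j)) ?u ?v)"
    by (simp add: resolvent_identity[OF G1 G2] T_diff)
  also have "\<dots> \<le> c * (Im (sform N (T M1) ?u ?u) + Im (sform N (T M2) ?v ?v))"
    using c(2) by (intro T_dominated) (simp add: dominated_def)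
  also have "\<dots> \<le> c * ((1 - \<delta>) * Im (sform N G1 u u) + (1 - \<delta>) * Im (sform N G2 v v))"
  proof (intro mult_left_mono add_mono c(1))
    show "Im (sform N (T M1) ?u ?u) \<le> (1 - \<delta>) * Im (sform N G1 u u)"
      using Im_sform_resolvent_le[OF M1 G1 admissible_le_left[OF M1 G1, of u]]
        Im_sform_resolvent_left[OF G1, of u] unfolding left_diff_distrib mult_1 by linarith
    show "Im (sform N (T M2) ?v ?v) \<le> (1 - \<delta>) * Im (sform N G2 v v)"
      using Im_sform_resolvent_le[OF M2 G2 admissible_le_right[OF M2 G2, of v]]
        Im_sform_resolvent_right[OF G2, of v] unfolding left_diff_distrib mult_1 by linarith
  qed
  finally show "2 * cmod (sform N (\<lambda>i j. G1 i j - G2 i j) u v)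
      \<le> c * (1 - \<delta>) * (Im (sform N G1 u u) + Im (sform N G2 v v))"
    by (simp add: algebra_simps)
qed

text \<open>Both norms are at most 1 / Im z, which gives the factor 2 / Im z after AM-GM; the lower
  bounds by \<epsilon> replace squared norms by imaginary forms.\<close>

lemma dominated_start:
  assumes M1: "admissible M1" "\<And>v. \<epsilon> * (vnorm N v)\<^sup>2 \<le> Im (sform N M1 v v)"
    and M2: "admissible M2" "\<And>v. \<epsilon> * (vnorm N v)\<^sup>2 \<le> Im (sform N M2 v v)"
  shows "dominated (2 / (Im z * \<epsilon>)) (\<lambda>i j. M1 i j - M2 i j) M1 M2"
  unfolding dominated_def
proof (intro allI)
  fix u v
  have le: "cmod (sform N M u v) \<le> 1 / Im z * (vnorm N u * vnorm N v)" if "admissible M" for M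
    using that by (intro cmod_sform_le) (simp add: admissible_def)
  have "2 * cmod (sform N (\<lambda>i j. M1 i j - M2 i j) u v) \<le> 2 / Im z * (2 * (vnorm N u * vnorm N v))"
    unfolding sform_diff
    using norm_triangle_ineq4[of "sform N M1 u v" "sform N M2 u v"] le[OF M1(1)] le[OF M2(1)]
    by simp
  also have "\<dots> \<le> 2 / Im z * ((vnorm N u)\<^sup>2 + (vnorm N v)\<^sup>2)"
    using Im_z_pos by (intro mult_left_mono two_mult_le_sq_sum) auto
  also have "\<dots> = 2 / (Im z * \<epsilon>) * (\<epsilon> * (vnorm N u)\<^sup>2 + \<epsilon> * (vnorm N v)\<^sup>2)"
    using eps_pos Im_z_pos by (simp add: field_simps)
  also have "\<dots> \<le> 2 / (Im z * \<epsilon>) * (Im (sform N M1 u u) + Im (sform N M2 v v))"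
    using Im_z_pos eps_pos by (intro mult_left_mono add_mono M1 M2) auto
  finally show "2 * cmod (sform N (\<lambda>i j. M1 i j - M2 i j) u v)
    \<le> 2 / (Im z * \<epsilon>) * (Im (sform N M1 u u) + Im (sform N M2 v v))" .
qed

text \<open>Testing with unit vectors turns domination into entrywise bounds, which suffice for
  equality and for convergence.\<close>

lemma dominated_entry_le:
  assumes "c \<ge> 0" "admissible M1" "admissible M2" "dominated c X M1 M2" "i < N" "j < N"
  shows "cmod (X i j) \<le> c / Im z"
proof -
  let ?e = "\<lambda>i k. if k = i then 1 else 0 :: complex"
  have le: "Im (sform N M (?e k) (?e k)) \<le> 1 / Im z" if "admissible M" "k < N" for M k
  proof -
    have "Im (sform N M (?e k) (?e k)) \<le> cmod (sform N M (?e k) (?e k))"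
      using abs_Im_le_cmod[of "sform N M (?e k) (?e k)"] by simp
    also have "\<dots> \<le> 1 / Im z * (vnorm N (?e k) * vnorm N (?e k))"
      using that by (intro cmod_sform_le) (simp add: admissible_def)
    finally show ?thesis using vnorm_unit[OF that(2)] by simp
  qed
  have "2 * cmod (X i j) \<le> c * (Im (sform N M1 (?e i) (?e i)) + Im (sform N M2 (?e j) (?e j)))"
    using assms(4) sform_unit[OF assms(5,6), of X] unfolding dominated_def by metis
  also have "\<dots> \<le> c * (1 / Im z + 1 / Im z)"
    using assms le by (intro mult_left_mono add_mono) auto
  finally show ?thesis using Im_z_pos by (simp add: field_simps)
qed

section \<open>Uniqueness and existence of the solution\<close>

lemma solution_resolvent:
  assumes "M \<in> Mplus N" "mmul N M (shifted N z (T M)) = idm N"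
  shows "resolvent_of N z (T M) M" "admissible M"
proof -
  have pos: "0 \<le> Im (sform N M u u)" for u
  proof (cases "vnorm N u > 0")
    case True
    then show ?thesis using assms(1) by (auto simp: Mplus_def mat_gt_imag_part_iff less_imp_le)
  next
    case False
    then have "\<forall>i<N. u i = 0" by (simp add: vnorm_pos_iff)
    then show ?thesis by (simp add: sform_def)
  qed
  \<comment> \<open>Only a left inverse is given. A two-sided inverse G exists by positivity, and
    associativity identifies M with it.\<close>
  obtain G where G: "resolvent_of N z (T M) G"
    using resolvent_exists[OF Im_z_pos sq_T T_pos[OF pos]] by blast
  have sq: "sq_mat N M" "sq_mat N G" using assms(1) G by (simp_all add: Mplus_def resolvent_of_def)
  have "M = mmul N M (mmul N (shifted N z (T M)) G)"
    using G sq by (simp add: resolvent_of_def mmul_idm_right)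
  also have "\<dots> = G"
    using assms(2) sq by (simp add: mmul_idm_left flip: mmul_assoc)
  finally show res: "resolvent_of N z (T M) M" using G by simp
  show "admissible M"
    using pos vnorm_resolvent_le[OF Im_z_pos T_pos[OF pos] res] by (simp add: admissible_def)
qed

lemma solution_unique:
  assumes "M1 \<in> Mplus N" "mmul N M1 (shifted N z (T M1)) = idm N"
    and "M2 \<in> Mplus N" "mmul N M2 (shifted N z (T M2)) = idm N"
  shows "M1 = M2"
proof (intro ext)
  fix i j
  note 1 = solution_resolvent[OF assms(1,2)] and 2 = solution_resolvent[OF assms(3,4)]
  show "M1 i j = M2 i j"
  proof (cases "i < N \<and> j < N")
    case True
    define c where "c = 2 / (Im z * \<epsilon>)"
    have c: "c \<ge> 0" using Im_z_pos eps_pos by (simp add: c_def)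
    \<comment> \<open>Each solution is its own resolvent, so the contraction applies to the same
      pair arbitrarily often.\<close>
    have dom: "dominated (c * (1 - \<delta>) ^ n) (\<lambda>i j. M1 i j - M2 i j) M1 M2" for n
    proof (induction n)
      case 0
      show ?case using dominated_start[of M1 M2] 1 2 Im_sform_resolvent_ge by (simp add: c_def)
    next
      case (Suc n)
      have "0 \<le> c * (1 - \<delta>) ^ n" using c delta_le_1 by simp
      from dominated_contract[OF 1(2) 2(2) 1(1) 2(1) this Suc.IH] show ?case by (simp add: mult_ac)
    qed
    have "cmod (M1 i j - M2 i j) \<le> c * (1 - \<delta>) ^ n / Im z" for n
      using dominated_entry_le[OF _ 1(2) 2(2) dom] True c delta_le_1 by simp
    moreover have "(\<lambda>n. c * (1 - \<delta>) ^ n / Im z) \<longlonglongrightarrow> c * 0 / Im z"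
      using delta_pos delta_le_1 Im_z_pos by (intro tendsto_intros LIMSEQ_power_zero) auto
    ultimately have "cmod (M1 i j - M2 i j) \<le> c * 0 / Im z"
      by (intro LIMSEQ_le_const) auto
    then show ?thesis by simp
  next
    case False
    then show ?thesis using assms(1,3) by (auto simp: Mplus_def sq_mat_def)
  qed
qed

lemma solution_exists: "\<exists>M. M \<in> Mplus N \<and> mmul N M (shifted N z (T M)) = idm N"
proof -
  have "\<forall>M. \<exists>G. admissible M \<longrightarrow> resolvent_of N z (T M) G"
    using resolvent_exists[OF Im_z_pos sq_T] admissible_T_pos by metis
  then obtain \<Phi> where \<Phi>: "\<And>M. admissible M \<Longrightarrow> resolvent_of N z (T M) (\<Phi> M)" by metis
  \<comment> \<open>The index is shifted by one because the zero matrix lacks the lower bound by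
    \<epsilon>; every \<open>S n\<close> is a resolvent and has it.\<close>
  define S where "S n = (\<Phi> ^^ Suc n) (\<lambda>_ _. 0)" for n
  have "admissible (\<lambda>_ _. 0)"
    using Im_z_pos by (simp add: admissible_def sform_def mvec_def vnorm_def L2_set_0')
  then have "admissible ((\<Phi> ^^ n) (\<lambda>_ _. 0))" for n
    by (induction n) (auto intro: admissible_resolvent \<Phi>)
  then have res: "\<exists>M. admissible M \<and> resolvent_of N z (T M) (S n)" for n
    using \<Phi> by (auto simp: S_def)
  have adm: "admissible (S n)" and ge: "\<epsilon> * (vnorm N v)\<^sup>2 \<le> Im (sform N (S n) v v)"
    and sq: "sq_mat N (S n)" for n v
    using res[of n] admissible_resolvent Im_sform_resolvent_ge by (auto simp: resolvent_of_def)
  have S_Suc: "resolvent_of N z (T (S n)) (S (Suc n))" for n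
    using \<Phi>[OF adm[of n]] by (simp add: S_def)
  define c where "c = 2 / (Im z * \<epsilon>)"
  have c: "c \<ge> 0" using Im_z_pos eps_pos by (simp add: c_def)
  have dom: "dominated (c * (1 - \<delta>) ^ n) (\<lambda>i j. S n i j - S (Suc n) i j) (S n) (S (Suc n))" for n
  proof (induction n)
    case 0
    show ?case using dominated_start[OF adm ge adm ge] by (simp add: c_def)
  next
    case (Suc n)
    have "0 \<le> c * (1 - \<delta>) ^ n" using c delta_le_1 by simp
    from dominated_contract[OF adm adm S_Suc S_Suc this Suc.IH] show ?case by (simp add: mult_ac)
  qed
  have "convergent (\<lambda>n. S n i j)" for i j
  proof (cases "i < N \<and> j < N")
    case True
    have "cmod (S n i j - S (Suc n) i j) \<le> c * (1 - \<delta>) ^ n / Im z" for n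
      using dominated_entry_le[OF _ adm adm dom] True c delta_le_1 by simp
    then have le: "cmod (S (Suc n) i j - S n i j) \<le> c * (1 - \<delta>) ^ n / Im z" for n
      by (metis norm_minus_commute)
    \<comment> \<open>A geometric series majorizes the increments, so the telescoping series of the
      entries converges.\<close>
    have "summable (\<lambda>n. c * (1 - \<delta>) ^ n / Im z)"
      using delta_pos delta_le_1 by (intro summable_divide summable_mult summable_geometric) auto
    then have "summable (\<lambda>n. S (Suc n) i j - S n i j)"
      using le by (rule summable_comparison_test')
    then have "(\<lambda>n. S 0 i j + (\<Sum>k<n. S (Suc k) i j - S k i j))
        \<longlonglongrightarrow> S 0 i j + (\<Sum>k. S (Suc k) i j - S k i j)"
      by (intro tendsto_intros summable_LIMSEQ)
    then show ?thesis
      unfolding convergent_def sum_lessThan_telescope[of "\<lambda>n. S n i j"] by auto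
  next
    case False
    then have "S n i j = 0" for n using sq by (auto simp: sq_mat_def)
    then show ?thesis by (simp add: convergent_const)
  qed
  then obtain L where L: "\<And>i j. (\<lambda>n. S n i j) \<longlonglongrightarrow> L i j"
    unfolding convergent_def by metis
  have L0: "L i j = 0" if "N \<le> i \<or> N \<le> j" for i j
  proof -
    have "S n i j = 0" for n using sq that by (auto simp: sq_mat_def)
    then show ?thesis using L[of i j] by (simp add: LIMSEQ_const_iff)
  qed
  \<comment> \<open>The uniform bound survives the limit and keeps positivity strict there.\<close>
  have "\<epsilon> * (vnorm N v)\<^sup>2 \<le> Im (sform N L v v)" for v
  proof (rule LIMSEQ_le_const)
    show "(\<lambda>n. Im (sform N (S n) v v)) \<longlonglongrightarrow> Im (sform N L v v)"
      unfolding sform_def by (intro tendsto_intros L)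
  qed (use ge in blast)
  moreover have "0 < \<epsilon> * (vnorm N v)\<^sup>2" if "vnorm N v > 0" for v
    using eps_pos that by simp
  ultimately have "L \<in> Mplus N"
    using L0 by (auto simp: Mplus_def sq_mat_def mat_gt_imag_part_iff intro: less_le_trans)
  moreover have "mmul N L (shifted N z (T L)) i k = idm N i k" for i k
  proof -
    have "(\<lambda>n. mmul N (S (Suc n)) (shifted N z (T (S n))) i k) \<longlonglongrightarrow> mmul N L (shifted N z (T L)) i k"
      unfolding mmul_def shifted_def by (intro tendsto_intros LIMSEQ_Suc L T_tendsto)
    moreover have "mmul N (S (Suc n)) (shifted N z (T (S n))) i k = idm N i k" for n
      using S_Suc by (simp add: resolvent_of_def)
    ultimately show ?thesis by (simp add: LIMSEQ_const_iff)
  qed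
  ultimately show ?thesis by blast
qed

text \<open>A substitute for Cauchy-Schwarz. At v = w the second term on the right of the domination
  vanishes; the left side is then of degree one in u and the right side of degree two, so scaling u
  to 0 forces <u, T(M) w> = 0.\<close>

lemma T_mvec_eq_0:
  assumes M: "admissible M" "\<And>v. \<epsilon> * (vnorm N v)\<^sup>2 \<le> Im (sform N M v v)"
    and w: "Im (sform N (T M) w w) = 0"
  shows "vnorm N (mvec N (T M) w) = 0"
proof -
  \<comment> \<open>Im A[u] = \<epsilon> |u|^2, and c \<epsilon> = 1 / Im z matches the norm bound
    on M.\<close>
  define A where "A = (\<lambda>i j. \<epsilon> * \<i> * idm N i j)"
  define c where "c = 1 / (Im z * \<epsilon>)"
  have "2 * cmod (sform N M u v) \<le> c * (Im (sform N A u u) + Im (sform N M v v))" for u v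
  proof -
    have "2 * cmod (sform N M u v) \<le> 1 / Im z * (2 * (vnorm N u * vnorm N v))"
      using M(1) cmod_sform_le[of N M "1 / Im z" u v] by (simp add: admissible_def)
    also have "\<dots> \<le> 1 / Im z * ((vnorm N u)\<^sup>2 + (vnorm N v)\<^sup>2)"
      using Im_z_pos by (intro mult_left_mono two_mult_le_sq_sum) auto
    also have "\<dots> = c * (\<epsilon> * (vnorm N u)\<^sup>2 + \<epsilon> * (vnorm N v)\<^sup>2)"
      using eps_pos Im_z_pos by (simp add: c_def field_simps)
    also have "\<dots> \<le> c * (Im (sform N A u u) + Im (sform N M v v))"
      using Im_z_pos eps_pos M(2)[of v]
      by (intro mult_left_mono add_mono) (auto simp: c_def A_def sform_idm cinner_self)
    finally show ?thesis .
  qed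
  from T_dominated[OF this] w
  have le: "2 * cmod (sform N (T M) u w) \<le> c * Im (sform N (T A) u u)" for u by (metis add.right_neutral)
  define u where "u = mvec N (T M) w"
  define a where "a = c * Im (sform N (T A) u u)"
  define q where "q = cmod (sform N (T M) u w)"
  have q: "q = (vnorm N u)\<^sup>2"
    by (simp add: q_def sform_mvec cinner_self norm_power flip: u_def)
  \<comment> \<open>The vector u = T(M) w is scaled by t, and one factor t cancels.\<close>
  have "2 * q \<le> t * a" if "t > 0" for t :: real
  proof -
    have "2 * (t * q) \<le> t * (t * a)"
      using le[of "\<lambda>i. of_real t * u i"] that
      unfolding sform_scale_left sform_scale_right by (simp add: norm_mult a_def q_def mult_ac)
    with that show ?thesis by (simp add: mult.left_commute)
  qed
  then have "2 * q \<le> 0 * a"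
    by (intro tendsto_lowerbound[of "\<lambda>t. t * a" "0 * a" "at_right 0"] tendsto_intros)
      (auto simp: eventually_at_right_less eventually_at_filter)
  with q show ?thesis by (simp add: u_def[symmetric])
qed

text \<open>C will be 2 K and \<kappa> is K + 1. As they agree for K = 1, strictness cannot come
  from \<kappa> < C; it comes from Im T(M)[w] or, if that vanishes, from C > 0.\<close>

lemma solution_bounds:
  assumes sol: "M \<in> Mplus N" "mmul N M (shifted N z (T M)) = idm N"
    and C: "\<kappa> \<le> C" "C > 0"
  shows "M \<in> Meps N (Im z * (C / Im z + cmod z) powr (-2)) (4 / Im z)"
proof -
  note res = solution_resolvent(1)[OF sol] and adm = solution_resolvent(2)[OF sol]
  define b where "b = C / Im z + cmod z"
  have b: "b > 0" "cmod z < b" "\<beta> \<le> b"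
    using C Im_z_pos by (auto simp: b_def \<beta>_def add_pos_nonneg divide_right_mono)
  have "opnorm N M \<le> 1 / Im z"
    using adm Im_z_pos by (intro opnorm_le) (auto simp: admissible_def)
  also have "\<dots> < 4 / Im z" using Im_z_pos by (intro divide_strict_right_mono) auto
  finally have "opnorm N M < 4 / Im z" .
  moreover have "Im (sform N M v v) > Im z * b powr (-2) * (vnorm N v)\<^sup>2" if v: "vnorm N v > 0" for v
  proof -
    define w where "w = mvec N M v"
    have eq: "Im (sform N M v v) = Im z * (vnorm N w)\<^sup>2 + Im (sform N (T M) w w)"
      unfolding w_def by (rule Im_sform_resolvent_right[OF res])
    have "0 < \<beta> * vnorm N w"
      using admissible_le_right[OF adm res, of v] v by (simp add: w_def)
    then have w: "vnorm N w > 0" using beta_pos by (simp add: zero_less_mult_iff)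
    have powr: "b powr (-2) = 1 / b\<^sup>2"
      using b(1) by (simp add: powr_minus powr_numeral divide_inverse)
    \<comment> \<open>In the first case this term itself makes the bound strict. In the second T(M)
      w = 0, so v = -z w and |v| = |z| |w| < b |w|.\<close>
    consider "Im (sform N (T M) w w) > 0" | "Im (sform N (T M) w w) = 0"
      using admissible_T_pos[OF adm, of w] by linarith
    then show ?thesis
    proof cases
      case 1
      have "vnorm N v \<le> b * vnorm N w"
        using admissible_le_right[OF adm res, of v] b(3) w
        by (metis w_def mult_right_mono order_trans less_imp_le)
      then have "(vnorm N v)\<^sup>2 \<le> (b * vnorm N w)\<^sup>2" by (intro power_mono) auto
      then have "Im z * b powr (-2) * (vnorm N v)\<^sup>2 \<le> Im z * (vnorm N w)\<^sup>2"
        using b(1) Im_z_pos unfolding powr by (simp add: field_simps power_mult_distrib)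
      with 1 eq show ?thesis by linarith
    next
      case 2
      have "vnorm N (mvec N (T M) w) = 0"
        using T_mvec_eq_0[OF adm Im_sform_resolvent_ge[OF adm res] 2] .
      then have 0: "mvec N (T M) w i = 0" if "i < N" for i
        using that by (simp add: vnorm_eq_0_iff)
      have "v i = - z * w i" if "i < N" for i
      proof -
        have "v i = mvec N (shifted N z (T M)) w i"
          using resolvent_of_right[OF res that, of v] by (simp add: w_def)
        also have "\<dots> = - z * mvec N (idm N) w i - mvec N (T M) w i"
          by (simp add: mvec_def shifted_def algebra_simps sum_subtractf sum_negf sum_distrib_left)
        finally show ?thesis using 0[OF that] mvec_idm[OF that] by simp
      qed
      then have "vnorm N v = vnorm N (\<lambda>i. - z * w i)" by (rule vnorm_cong)
      then have "vnorm N v = cmod z * vnorm N w" by (simp only: vnorm_scale norm_minus_cancel)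
      then have "vnorm N v < b * vnorm N w" using b(2) w by simp
      then have "(vnorm N v)\<^sup>2 < (b * vnorm N w)\<^sup>2" by (intro power_strict_mono) auto
      then have "Im z * b powr (-2) * (vnorm N v)\<^sup>2 < Im z * (vnorm N w)\<^sup>2"
        using b(1) Im_z_pos unfolding powr by (simp add: field_simps power_mult_distrib)
      with 2 eq show ?thesis by linarith
    qed
  qed
  ultimately show ?thesis
    using sol(1) by (simp add: Meps_def Mplus_def mat_gt_imag_part_iff b_def)
qed

end

section \<open>Covariance maps\<close>

lemma integrable_mult_of_squares:
  fixes f g :: "'a \<Rightarrow> real"
  assumes "f \<in> borel_measurable P" "g \<in> borel_measurable P"
    and "integrable P (\<lambda>\<omega>. (f \<omega>)\<^sup>2)" "integrable P (\<lambda>\<omega>. (g \<omega>)\<^sup>2)"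
  shows "integrable P (\<lambda>\<omega>. f \<omega> * g \<omega>)"
proof (rule Bochner_Integration.integrable_bound)
  show "integrable P (\<lambda>\<omega>. (f \<omega>)\<^sup>2 + (g \<omega>)\<^sup>2)" using assms by simp
  show "(\<lambda>\<omega>. f \<omega> * g \<omega>) \<in> borel_measurable P" using assms by simp
  have "\<bar>a * b\<bar> \<le> a\<^sup>2 + b\<^sup>2" for a b :: real
    using two_mult_le_sq_sum[of "\<bar>a\<bar>" "\<bar>b\<bar>"] by (simp add: abs_mult) (smt (verit) mult_nonneg_nonneg abs_ge_zero)
  then show "AE \<omega> in P. norm (f \<omega> * g \<omega>) \<le> norm ((f \<omega>)\<^sup>2 + (g \<omega>)\<^sup>2)" by simp
qed

text \<open>Independence from a whole family passes to a single coordinate, since preimages under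
  \<open>Z p\<close> are preimages of cylinder sets; then the expectation of the product
  factorizes.\<close>

lemma (in prob_space) uncorrelated_of_indep:
  fixes X Y :: "'a \<Rightarrow> real" and Z :: "'b \<Rightarrow> 'a \<Rightarrow> real"
  assumes ind: "indep_set {X -` A \<inter> space M | A. A \<in> sets borel}
      {(\<lambda>\<omega>. restrict (\<lambda>p. Z p \<omega>) I) -` C \<inter> space M | C. C \<in> sets (PiM I (\<lambda>_. borel))}"
    and p: "p \<in> I" and X: "integrable M X" "expectation X = 0" and Y: "integrable M (Z p)"
  shows "expectation (\<lambda>\<omega>. X \<omega> * Z p \<omega>) = 0"
proof -
  let ?A = "{X -` A \<inter> space M | A. A \<in> sets borel}"
  let ?B = "{Z p -` A \<inter> space M | A. A \<in> sets borel}"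
  have sub: "?B \<subseteq> {(\<lambda>\<omega>. restrict (\<lambda>p. Z p \<omega>) I) -` C \<inter> space M | C. C \<in> sets (PiM I (\<lambda>_. borel))}"
  proof
    fix b assume "b \<in> ?B"
    then obtain A where A: "A \<in> sets borel" "b = Z p -` A \<inter> space M" by blast
    \<comment> \<open>The cylinder over \<open>A\<close> in coordinate \<open>p\<close>.\<close>
    let ?C = "(\<lambda>f. f p) -` A \<inter> space (PiM I (\<lambda>_. borel :: real measure))"
    have "?C \<in> sets (PiM I (\<lambda>_. borel))"
      by (rule measurable_sets[OF measurable_component_singleton[OF p] A(1)])
    moreover have "b = (\<lambda>\<omega>. restrict (\<lambda>p. Z p \<omega>) I) -` ?C \<inter> space M"
      using p A(2) by (auto simp: space_PiM)
    ultimately show "b \<in> {(\<lambda>\<omega>. restrict (\<lambda>p. Z p \<omega>) I) -` C \<inter> space M | C. C \<in> sets (PiM I (\<lambda>_. borel))}"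
      by blast
  qed
  have "indep_set ?A ?B"
    unfolding indep_sets2_eq
  proof (intro conjI ballI)
    show "?A \<subseteq> events" "?B \<subseteq> events"
      using ind sub unfolding indep_sets2_eq by (simp, meson subset_trans)
    show "prob (a \<inter> b) = prob a * prob b" if "a \<in> ?A" "b \<in> ?B" for a b
      using that(1) subsetD[OF sub that(2)] by (rule indep_setD[OF ind])
  qed
  \<comment> \<open>\<open>indep_var_eq\<close> speaks of generated sigma-algebras, so the
    generators have to be closed under intersection.\<close>
  moreover have "Int_stable {W -` A \<inter> space M | A. A \<in> sets borel}" for W :: "'a \<Rightarrow> real"
  proof (rule Int_stableI)
    fix a b assume "a \<in> {W -` A \<inter> space M | A. A \<in> sets borel}" "b \<in> {W -` A \<inter> space M | A. A \<in> sets borel}"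
    then obtain A B where "A \<in> sets borel" "B \<in> sets borel" "a = W -` A \<inter> space M" "b = W -` B \<inter> space M"
      by blast
    then show "a \<inter> b \<in> {W -` A \<inter> space M | A. A \<in> sets borel}"
      by (intro CollectI exI[of _ "A \<inter> B"]) auto
  qed
  ultimately have "indep_set (sigma_sets (space M) ?A) (sigma_sets (space M) ?B)"
    by (intro indep_set_sigma_sets)
  then have "indep_var borel X borel (Z p)"
    unfolding indep_var_eq using X Y by auto
  from indep_var_lebesgue_integral[OF this X(1) Y] X(2) show ?thesis by simp
qed

text \<open>Variables whose indices lie in one residue class modulo K + 1 are uncorrelated, so it suffices to
  apply Cauchy--Schwarz over the K + 1 classes.  Summing the rows of the covariance matrix would only
  give 2 K + 1.\<close>

lemma banded_covariance_le:
  fixes y :: "nat \<Rightarrow> 'a \<Rightarrow> real" and u :: "nat \<Rightarrow> complex"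
  assumes I: "finite I"
    and int: "\<And>i k. i \<in> I \<Longrightarrow> k \<in> I \<Longrightarrow> integrable P (\<lambda>\<omega>. y i \<omega> * y k \<omega>)"
    and var: "\<And>i. i \<in> I \<Longrightarrow> integral\<^sup>L P (\<lambda>\<omega>. y i \<omega> * y i \<omega>) \<le> s i"
    and uncorr: "\<And>i k. i \<in> I \<Longrightarrow> k \<in> I \<Longrightarrow> i + K < k \<or> k + K < i \<Longrightarrow> integral\<^sup>L P (\<lambda>\<omega>. y i \<omega> * y k \<omega>) = 0"
  shows "integrable P (\<lambda>\<omega>. (cmod (\<Sum>i\<in>I. of_real (y i \<omega>) * u i))\<^sup>2)"
    and "integral\<^sup>L P (\<lambda>\<omega>. (cmod (\<Sum>i\<in>I. of_real (y i \<omega>) * u i))\<^sup>2)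
      \<le> real (Suc K) * (\<Sum>i\<in>I. s i * (cmod (u i))\<^sup>2)"
proof -
  define q where "q J \<omega> = (cmod (\<Sum>i\<in>J. of_real (y i \<omega>) * u i))\<^sup>2" for J \<omega>
  \<comment> \<open>The square is expanded as a double sum; its value is real, so real parts
    suffice.\<close>
  have q_eq: "q J \<omega> = (\<Sum>i\<in>J. \<Sum>k\<in>J. y i \<omega> * y k \<omega> * Re (u i * cnj (u k)))" for J \<omega>
  proof -
    have "complex_of_real (q J \<omega>) = (\<Sum>i\<in>J. \<Sum>k\<in>J. of_real (y i \<omega> * y k \<omega>) * (u i * cnj (u k)))"
      unfolding q_def complex_norm_square by (simp add: sum_product mult_ac)
    then have "q J \<omega> = Re (\<Sum>i\<in>J. \<Sum>k\<in>J. of_real (y i \<omega> * y k \<omega>) * (u i * cnj (u k)))"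
      by (metis Re_complex_of_real)
    then show ?thesis by (simp del: of_real_mult)
  qed
  have q_int: "integrable P (q J)" if "J \<subseteq> I" for J
    unfolding q_eq[abs_def] using int that by (intro Bochner_Integration.integrable_sum integrable_mult_left) auto
  have q_integral: "integral\<^sup>L P (q J)
      = (\<Sum>i\<in>J. \<Sum>k\<in>J. integral\<^sup>L P (\<lambda>\<omega>. y i \<omega> * y k \<omega>) * Re (u i * cnj (u k)))" if "J \<subseteq> I" for J
    unfolding q_eq[abs_def] using int that
    by (subst Bochner_Integration.integral_sum,
        force intro!: Bochner_Integration.integrable_sum integrable_mult_left,
        intro sum.cong refl, subst Bochner_Integration.integral_sum)
      (auto intro!: integrable_mult_left)
  show "integrable P (\<lambda>\<omega>. (cmod (\<Sum>i\<in>I. of_real (y i \<omega>) * u i))\<^sup>2)"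
    using q_int[of I] by (simp add: q_def[abs_def])
  define C where "C r = {i \<in> I. i mod Suc K = r}" for r
  have class_le: "integral\<^sup>L P (q (C r)) \<le> (\<Sum>i\<in>C r. s i * (cmod (u i))\<^sup>2)" for r
  proof -
    have "integral\<^sup>L P (\<lambda>\<omega>. y i \<omega> * y k \<omega>) = 0" if "i \<in> C r" "k \<in> C r" "i \<noteq> k" for i k
    proof (rule uncorr)
      \<comment> \<open>Distinct numbers in one residue class differ by a positive multiple of K +
        1.\<close>
      have far: "m + K < n" if "m < n" "m mod Suc K = n mod Suc K" for m n
      proof -
        have "Suc K dvd n - m" using that by (metis mod_eq_dvd_iff_nat less_imp_le)
        with \<open>m < n\<close> show ?thesis by (auto dest!: dvd_imp_le)
      qed
      show "i + K < k \<or> k + K < i"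
        using that far[of i k] far[of k i] by (cases i k rule: linorder_cases) (auto simp: C_def)
    qed (use that in \<open>auto simp: C_def\<close>)
    then have "integral\<^sup>L P (q (C r))
        = (\<Sum>i\<in>C r. \<Sum>k\<in>C r. if k = i then integral\<^sup>L P (\<lambda>\<omega>. y i \<omega> * y i \<omega>) * Re (u i * cnj (u i)) else 0)"
      by (subst q_integral) (auto simp: C_def intro!: sum.cong)
    also have "\<dots> = (\<Sum>i\<in>C r. integral\<^sup>L P (\<lambda>\<omega>. y i \<omega> * y i \<omega>) * (cmod (u i))\<^sup>2)"
      using I by (intro sum.cong) (auto simp: C_def complex_mult_cnj cmod_power2)
    also have "\<dots> \<le> (\<Sum>i\<in>C r. s i * (cmod (u i))\<^sup>2)"
      using var by (intro sum_mono mult_right_mono) (auto simp: C_def)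
    finally show ?thesis .
  qed
  have group: "(\<Sum>r<Suc K. \<Sum>i\<in>C r. h i) = (\<Sum>i\<in>I. h i)" for h :: "nat \<Rightarrow> 'b::comm_monoid_add"
    unfolding C_def by (rule sum.group) (use I in auto)
  have "q I \<omega> \<le> real (Suc K) * (\<Sum>r<Suc K. q (C r) \<omega>)" for \<omega>
  proof -
    let ?S = "\<lambda>J. \<Sum>i\<in>J. complex_of_real (y i \<omega>) * u i"
    have "cmod (?S I) \<le> (\<Sum>r<Suc K. cmod (?S (C r)))"
      unfolding group[of "\<lambda>i. complex_of_real (y i \<omega>) * u i", symmetric] by (rule norm_sum)
    then have "q I \<omega> \<le> (\<Sum>r<Suc K. cmod (?S (C r)))\<^sup>2"
      unfolding q_def by (intro power_mono) auto
    also have "\<dots> \<le> (\<Sum>r<Suc K. (cmod (?S (C r)))\<^sup>2) * card {..<Suc K}"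
      by (rule sum_squared_le_sum_of_squares)
    finally show ?thesis by (simp add: q_def mult_ac)
  qed
  then have "integral\<^sup>L P (q I) \<le> integral\<^sup>L P (\<lambda>\<omega>. real (Suc K) * (\<Sum>r<Suc K. q (C r) \<omega>))"
    by (intro integral_mono q_int integrable_mult_right Bochner_Integration.integrable_sum) (auto simp: C_def)
  also have "\<dots> = real (Suc K) * (\<Sum>r<Suc K. integral\<^sup>L P (q (C r)))"
    by (subst integral_mult_right_zero, subst Bochner_Integration.integral_sum)
      (auto intro!: q_int simp: C_def)
  also have "\<dots> \<le> real (Suc K) * (\<Sum>r<Suc K. \<Sum>i\<in>C r. s i * (cmod (u i))\<^sup>2)"
    by (intro mult_left_mono sum_mono class_le) simp
  also have "\<dots> = real (Suc K) * (\<Sum>i\<in>I. s i * (cmod (u i))\<^sup>2)"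
    by (simp only: group)
  finally show "integral\<^sup>L P (\<lambda>\<omega>. (cmod (\<Sum>i\<in>I. of_real (y i \<omega>) * u i))\<^sup>2)
      \<le> real (Suc K) * (\<Sum>i\<in>I. s i * (cmod (u i))\<^sup>2)"
    by (simp add: q_def[abs_def])
qed

text \<open>With A the real random matrix with entries \<open>a i j \<omega>\<close>, this is A^T
  u.\<close>

definition tvec :: "nat \<Rightarrow> (nat \<Rightarrow> nat \<Rightarrow> 'a \<Rightarrow> real) \<Rightarrow> 'a \<Rightarrow> (nat \<Rightarrow> complex) \<Rightarrow> nat \<Rightarrow> complex" where
  "tvec N a \<omega> u = (\<lambda>j. \<Sum>i<N. of_real (a i j \<omega>) * u i)"

text \<open>This is the expectation of A M A^T.\<close>

definition cov_map :: "'a measure \<Rightarrow> (nat \<Rightarrow> nat \<Rightarrow> 'a \<Rightarrow> real) \<Rightarrow> nat \<Rightarrow> (nat \<Rightarrow> nat \<Rightarrow> complex) \<Rightarrow> nat \<Rightarrow> nat \<Rightarrow> complex" where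
  "cov_map P a N M = (\<lambda>i k. \<Sum>j<N. \<Sum>l<N. of_real (integral\<^sup>L P (\<lambda>\<omega>. a i j \<omega> * a k l \<omega>)) * M j l)"

lemma sum_swap4:
  "(\<Sum>j\<in>A. \<Sum>l\<in>A. \<Sum>i\<in>A. \<Sum>k\<in>A. f i j k l) = (\<Sum>i\<in>A. \<Sum>k\<in>A. \<Sum>j\<in>A. \<Sum>l\<in>A. f i j k l)"
proof -
  have "(\<Sum>j\<in>A. \<Sum>l\<in>A. \<Sum>i\<in>A. \<Sum>k\<in>A. f i j k l) = (\<Sum>j\<in>A. \<Sum>i\<in>A. \<Sum>k\<in>A. \<Sum>l\<in>A. f i j k l)"
    by (rule sum.cong[OF refl], subst sum.swap, rule sum.cong[OF refl], rule sum.swap)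
  also have "\<dots> = (\<Sum>i\<in>A. \<Sum>k\<in>A. \<Sum>j\<in>A. \<Sum>l\<in>A. f i j k l)"
    by (subst sum.swap, rule sum.cong[OF refl], rule sum.swap)
  finally show ?thesis .
qed

lemma sform_tvec:
  "sform N M (tvec N a \<omega> u) (tvec N a \<omega> v)
   = (\<Sum>i<N. \<Sum>k<N. \<Sum>j<N. \<Sum>l<N. of_real (a i j \<omega> * a k l \<omega>) * (cnj (u i) * M j l * v k))"
  unfolding sform_def tvec_def
  by (subst sum_swap4[symmetric]) (simp add: sum_distrib_left sum_distrib_right mult_ac)

text \<open>A is real, so its adjoint is A^T, and <u, A M A^T v> = <A^T u, M A^T v> before taking
  expectations.\<close>

lemma sform_cov_map:
  assumes int: "\<And>i j k l. i < N \<Longrightarrow> j < N \<Longrightarrow> k < N \<Longrightarrow> l < N \<Longrightarrow> integrable P (\<lambda>\<omega>. a i j \<omega> * a k l \<omega>)"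
  shows "integrable P (\<lambda>\<omega>. sform N M (tvec N a \<omega> u) (tvec N a \<omega> v))"
    and "sform N (cov_map P a N M) u v = integral\<^sup>L P (\<lambda>\<omega>. sform N M (tvec N a \<omega> u) (tvec N a \<omega> v))"
proof -
  have int': "integrable P (\<lambda>\<omega>. complex_of_real (a i j \<omega> * a k l \<omega>) * c)"
    if "i < N" "j < N" "k < N" "l < N" for i j k l c
    by (intro integrable_mult_left integrable_of_real int that)
  show "integrable P (\<lambda>\<omega>. sform N M (tvec N a \<omega> u) (tvec N a \<omega> v))"
    unfolding sform_tvec by (intro Bochner_Integration.integrable_sum int') auto
  have "integral\<^sup>L P (\<lambda>\<omega>. sform N M (tvec N a \<omega> u) (tvec N a \<omega> v))
     = (\<Sum>i<N. \<Sum>k<N. \<Sum>j<N. \<Sum>l<N. integral\<^sup>L P (\<lambda>\<omega>. of_real (a i j \<omega> * a k l \<omega>) * (cnj (u i) * M j l * v k)))"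
    unfolding sform_tvec
    apply (subst Bochner_Integration.integral_sum, (intro Bochner_Integration.integrable_sum int'; simp))
    apply (intro sum.cong refl)
    apply (subst Bochner_Integration.integral_sum, (intro Bochner_Integration.integrable_sum int'; simp))
    apply (intro sum.cong refl)
    apply (subst Bochner_Integration.integral_sum, (intro Bochner_Integration.integrable_sum int'; simp))
    apply (intro sum.cong refl)
    apply (subst Bochner_Integration.integral_sum, (intro Bochner_Integration.integrable_sum int'; simp))
    apply (rule refl)
    done
  also have "\<dots> = sform N (cov_map P a N M) u v"
    unfolding sform_def cov_map_def sum_distrib_left sum_distrib_right
  proof (intro sum.cong refl)
    fix i k j l assume *: "i \<in> {..<N}" "k \<in> {..<N}" "j \<in> {..<N}" "l \<in> {..<N}"
    have "integral\<^sup>L P (\<lambda>\<omega>. complex_of_real (a i j \<omega> * a k l \<omega>) * (cnj (u i) * M j l * v k))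
      = of_real (integral\<^sup>L P (\<lambda>\<omega>. a i j \<omega> * a k l \<omega>)) * (cnj (u i) * M j l * v k)"
      by (simp only: integral_mult_left_zero integral_complex_of_real)
    then show "integral\<^sup>L P (\<lambda>\<omega>. complex_of_real (a i j \<omega> * a k l \<omega>) * (cnj (u i) * M j l * v k))
      = cnj (u i) * (of_real (integral\<^sup>L P (\<lambda>\<omega>. a i j \<omega> * a k l \<omega>)) * M j l) * v k"
      by (simp only: mult_ac)
  qed
  finally show "sform N (cov_map P a N M) u v = integral\<^sup>L P (\<lambda>\<omega>. sform N M (tvec N a \<omega> u) (tvec N a \<omega> v))" ..
qed

text \<open>The hypothesis holds for each \<omega> at the vectors A^T u and A^T v; integrating it
  preserves the inequality.\<close>

lemma cov_map_dominated:
  assumes int: "\<And>i j k l. i < N \<Longrightarrow> j < N \<Longrightarrow> k < N \<Longrightarrow> l < N \<Longrightarrow> integrable P (\<lambda>\<omega>. a i j \<omega> * a k l \<omega>)"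
    and dom: "\<And>u v. 2 * cmod (sform N X u v) \<le> c * (Im (sform N A u u) + Im (sform N B v v))"
  shows "2 * cmod (sform N (cov_map P a N X) u v)
    \<le> c * (Im (sform N (cov_map P a N A) u u) + Im (sform N (cov_map P a N B) v v))"
proof -
  note si = sform_cov_map(1)[OF int] and se = sform_cov_map(2)[OF int]
  have "2 * cmod (sform N (cov_map P a N X) u v)
      \<le> 2 * integral\<^sup>L P (\<lambda>\<omega>. cmod (sform N X (tvec N a \<omega> u) (tvec N a \<omega> v)))"
    using integral_norm_bound[of P "\<lambda>\<omega>. sform N X (tvec N a \<omega> u) (tvec N a \<omega> v)"] by (simp add: se)
  also have "\<dots> = integral\<^sup>L P (\<lambda>\<omega>. 2 * cmod (sform N X (tvec N a \<omega> u) (tvec N a \<omega> v)))"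
    by simp
  also have "\<dots> \<le> integral\<^sup>L P (\<lambda>\<omega>. c * (Im (sform N A (tvec N a \<omega> u) (tvec N a \<omega> u))
      + Im (sform N B (tvec N a \<omega> v) (tvec N a \<omega> v))))"
    by (intro integral_mono dom integrable_mult_right integrable_norm si
        Bochner_Integration.integrable_add integrable_Im)
  also have "\<dots> = c * (Im (sform N (cov_map P a N A) u u) + Im (sform N (cov_map P a N B) v v))"
    by (simp add: se si)
  finally show ?thesis .
qed

lemma cov_map_unit:
  assumes int: "\<And>i j k l. i < N \<Longrightarrow> j < N \<Longrightarrow> k < N \<Longrightarrow> l < N \<Longrightarrow> integrable P (\<lambda>\<omega>. a i j \<omega> * a k l \<omega>)"
  shows "Im (sform N (cov_map P a N (\<lambda>i j. \<i> * idm N i j)) u u)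
    = integral\<^sup>L P (\<lambda>\<omega>. (vnorm N (tvec N a \<omega> u))\<^sup>2)"
proof -
  have "Im (sform N (cov_map P a N (\<lambda>i j. \<i> * idm N i j)) u u)
    = integral\<^sup>L P (\<lambda>\<omega>. Im (sform N (\<lambda>i j. \<i> * idm N i j) (tvec N a \<omega> u) (tvec N a \<omega> u)))"
    by (simp add: sform_cov_map[OF int])
  then show ?thesis by (simp add: sform_idm cinner_self)
qed

section \<open>The self-energy map\<close>

lemma Im_of_real_mult: "Im (complex_of_real r * c) = r * Im c"
  by simp

text \<open>\<open>xi\<close> has no terms pairing an upper index pair with a strictly lower one, so
  the self-energy is not the covariance map of one symmetric matrix but the sum of two, one for each
  triangle.\<close>

definition upper_part :: "(nat \<Rightarrow> nat \<Rightarrow> 'a \<Rightarrow> real) \<Rightarrow> nat \<Rightarrow> nat \<Rightarrow> 'a \<Rightarrow> real" where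
  "upper_part x = (\<lambda>i j \<omega>. if i \<le> j then x i j \<omega> else 0)"

text \<open>The strict inequality leaves the diagonal to \<open>upper_part\<close> alone.\<close>

definition lower_part :: "(nat \<Rightarrow> nat \<Rightarrow> 'a \<Rightarrow> real) \<Rightarrow> nat \<Rightarrow> nat \<Rightarrow> 'a \<Rightarrow> real" where
  "lower_part x = (\<lambda>i j \<omega>. if j < i then x j i \<omega> else 0)"

lemma xi_eq:
  "xi P x i j k l = integral\<^sup>L P (\<lambda>\<omega>. upper_part x i j \<omega> * upper_part x k l \<omega>)
     + integral\<^sup>L P (\<lambda>\<omega>. lower_part x i j \<omega> * lower_part x k l \<omega>)"
  by (auto simp: xi_def upper_part_def lower_part_def)

lemma sform_Xi:
  "sform N (Xi P x N M) u v = complex_of_real (1 / real N)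
     * (sform N (cov_map P (upper_part x) N M) u v + sform N (cov_map P (lower_part x) N M) u v)"
proof -
  have "sform N (Xi P x N M) u v = sform N (\<lambda>i k. complex_of_real (1 / real N) *
      (cov_map P (upper_part x) N M i k + cov_map P (lower_part x) N M i k)) u v"
    by (rule sform_cong)
      (simp add: Xi_def cov_map_def xi_eq distrib_right sum.distrib add_divide_distrib)
  then show ?thesis
    by (simp add: sform_def algebra_simps sum.distrib sum_distrib_left)
qed

lemma Xi_dominated:
  assumes int: "\<And>i j k l. i < N \<Longrightarrow> j < N \<Longrightarrow> k < N \<Longrightarrow> l < N \<Longrightarrow> integrable P (\<lambda>\<omega>. upper_part x i j \<omega> * upper_part x k l \<omega>)"
      "\<And>i j k l. i < N \<Longrightarrow> j < N \<Longrightarrow> k < N \<Longrightarrow> l < N \<Longrightarrow> integrable P (\<lambda>\<omega>. lower_part x i j \<omega> * lower_part x k l \<omega>)"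
    and dom: "\<And>u v. 2 * cmod (sform N X u v) \<le> c * (Im (sform N A u u) + Im (sform N B v v))"
  shows "2 * cmod (sform N (Xi P x N X) u v)
    \<le> c * (Im (sform N (Xi P x N A) u u) + Im (sform N (Xi P x N B) v v))"
proof -
  let ?U = "cov_map P (upper_part x) N" and ?L = "cov_map P (lower_part x) N"
  have "2 * cmod (sform N (Xi P x N X) u v)
      = 1 / real N * (2 * cmod (sform N (?U X) u v + sform N (?L X) u v))"
    unfolding sform_Xi norm_mult by (simp add: norm_divide)
  also have "\<dots> \<le> 1 / real N * (2 * cmod (sform N (?U X) u v) + 2 * cmod (sform N (?L X) u v))"
    using norm_triangle_ineq[of "sform N (?U X) u v" "sform N (?L X) u v"]
    by (intro mult_left_mono) auto
  also have "\<dots> \<le> 1 / real N * (c * (Im (sform N (?U A) u u) + Im (sform N (?U B) v v))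
      + c * (Im (sform N (?L A) u u) + Im (sform N (?L B) v v)))"
    by (intro mult_left_mono add_mono cov_map_dominated int dom) auto
  also have "\<dots> = c * (Im (sform N (Xi P x N A) u u) + Im (sform N (Xi P x N B) v v))"
    unfolding sform_Xi Im_of_real_mult by (simp add: algebra_simps)
  finally show ?thesis .
qed

text \<open>The squared norm of A^T u splits over the columns of A, and
  \<open>banded_covariance_le\<close> applies to each column. The weights \<open>s\<close> keep
  track of which entries are present.\<close>

lemma vnorm_tvec_le:
  assumes int: "\<And>i k j. i < N \<Longrightarrow> k < N \<Longrightarrow> j < N \<Longrightarrow> integrable P (\<lambda>\<omega>. a i j \<omega> * a k j \<omega>)"
    and var: "\<And>i j. i < N \<Longrightarrow> j < N \<Longrightarrow> integral\<^sup>L P (\<lambda>\<omega>. a i j \<omega> * a i j \<omega>) \<le> s i j"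
    and uncorr: "\<And>i k j. i < N \<Longrightarrow> k < N \<Longrightarrow> j < N \<Longrightarrow> i + K < k \<or> k + K < i \<Longrightarrow>
      integral\<^sup>L P (\<lambda>\<omega>. a i j \<omega> * a k j \<omega>) = 0"
  shows "integral\<^sup>L P (\<lambda>\<omega>. (vnorm N (tvec N a \<omega> u))\<^sup>2)
    \<le> real (Suc K) * (\<Sum>j<N. \<Sum>i<N. s i j * (cmod (u i))\<^sup>2)"
proof -
  note col = banded_covariance_le[of "{..<N}" P "\<lambda>i. a i j" "\<lambda>i. s i j" K u for j]
  have "integral\<^sup>L P (\<lambda>\<omega>. (vnorm N (tvec N a \<omega> u))\<^sup>2)
      = (\<Sum>j<N. integral\<^sup>L P (\<lambda>\<omega>. (cmod (\<Sum>i<N. of_real (a i j \<omega>) * u i))\<^sup>2))"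
    unfolding vnorm_sq tvec_def
    by (intro Bochner_Integration.integral_sum col(1)) (auto intro: int var uncorr)
  also have "\<dots> \<le> (\<Sum>j<N. real (Suc K) * (\<Sum>i<N. s i j * (cmod (u i))\<^sup>2))"
    by (intro sum_mono col(2)) (auto intro: int var uncorr)
  finally show ?thesis by (simp add: sum_distrib_left)
qed

text \<open>It remains to verify the assumptions of \<open>dyson_equation\<close> for
  \<open>Xi P x N\<close> with \<kappa> = K + 1; independence enters through vanishing
  covariances.\<close>

theorem theorem4p6:
  fixes P :: "'a measure" and x :: "nat \<Rightarrow> nat \<Rightarrow> 'a \<Rightarrow> real"
    and N K :: nat and z :: complex
  assumes prob: "prob_space P"
    and K: "K \<ge> 1"
    and N: "N \<ge> 1"
    and meas: "\<And>i j. i \<le> j \<Longrightarrow> j < N \<Longrightarrow> x i j \<in> borel_measurable P"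
    and int1: "\<And>i j. i \<le> j \<Longrightarrow> j < N \<Longrightarrow> integrable P (x i j)"
    and int2: "\<And>i j. i \<le> j \<Longrightarrow> j < N \<Longrightarrow> integrable P (\<lambda>\<omega>. (x i j \<omega>)\<^sup>2)"
    and centered: "\<And>i j. i \<le> j \<Longrightarrow> j < N \<Longrightarrow> prob_space.expectation P (x i j) = 0"
    and var: "\<And>i j. i \<le> j \<Longrightarrow> j < N \<Longrightarrow> prob_space.variance P (x i j) \<le> 1"
    and indep: "\<And>i j. i \<le> j \<Longrightarrow> j < N \<Longrightarrow>
       prob_space.indep_set P
         {x i j -` A \<inter> space P | A. A \<in> sets borel}
         {(\<lambda>\<omega>. restrict (\<lambda>p. x (fst p) (snd p) \<omega>) {(k, l). k \<le> l \<and> l < N \<and> idist i j k l > K}) -` C \<inter> space P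
           | C. C \<in> sets (PiM {(k, l). k \<le> l \<and> l < N \<and> idist i j k l > K} (\<lambda>_. borel :: real measure))}"
    and z: "Im z > 0"
  shows "(\<exists>!M. M \<in> Mplus N \<and> mmul N M (\<lambda>i k. - z * idm N i k - Xi P x N M i k) = idm N)
       \<and> (\<forall>M. M \<in> Mplus N \<and> mmul N M (\<lambda>i k. - z * idm N i k - Xi P x N M i k) = idm N
            \<longrightarrow> M \<in> Meps N (Im z * (2 * real K / Im z + cmod z) powr (-2)) (4 / Im z))"
proof -
  have prod_int: "integrable P (\<lambda>\<omega>. x i j \<omega> * x k l \<omega>)"
    if "i \<le> j" "j < N" "k \<le> l" "l < N" for i j k l
    by (intro integrable_mult_of_squares meas int2 that)
  have second: "integral\<^sup>L P (\<lambda>\<omega>. x i j \<omega> * x i j \<omega>) \<le> 1" if "i \<le> j" "j < N" for i j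
    using var[OF that] centered[OF that] by (simp add: power2_eq_square)
  have uncorr: "integral\<^sup>L P (\<lambda>\<omega>. x i j \<omega> * x k l \<omega>) = 0"
    if "i \<le> j" "j < N" "k \<le> l" "l < N" "idist i j k l > K" for i j k l
    using prob_space.uncorrelated_of_indep[OF prob, of "x i j" "\<lambda>p. x (fst p) (snd p)" _ "(k, l)",
        OF indep[OF that(1,2)]] that int1 centered by simp
  have int_up: "integrable P (\<lambda>\<omega>. upper_part x i j \<omega> * upper_part x k l \<omega>)"
    if "i < N" "j < N" "k < N" "l < N" for i j k l
    by (cases "i \<le> j"; cases "k \<le> l") (use that prod_int[of i j k l] in \<open>simp_all add: upper_part_def\<close>)
  have int_low: "integrable P (\<lambda>\<omega>. lower_part x i j \<omega> * lower_part x k l \<omega>)"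
    if "i < N" "j < N" "k < N" "l < N" for i j k l
    by (cases "j < i"; cases "l < k") (use that prod_int[of j i l k] in \<open>simp_all add: lower_part_def\<close>)
  have unit_le: "Im (sform N (Xi P x N (\<lambda>i j. \<i> * idm N i j)) u u) \<le> real (Suc K) * (vnorm N u)\<^sup>2" for u
  proof -
    have "integral\<^sup>L P (\<lambda>\<omega>. (vnorm N (tvec N (upper_part x) \<omega> u))\<^sup>2)
        \<le> real (Suc K) * (\<Sum>j<N. \<Sum>i<N. (if i \<le> j then 1 else 0) * (cmod (u i))\<^sup>2)"
    proof (rule vnorm_tvec_le)
      fix i k j assume *: "i < N" "k < N" "j < N" "i + K < k \<or> k + K < i"
      then have "idist i j k j > K" by (auto simp: idist_def)
      with * show "integral\<^sup>L P (\<lambda>\<omega>. upper_part x i j \<omega> * upper_part x k j \<omega>) = 0"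
        using uncorr[of i j k j] by (cases "i \<le> j"; cases "k \<le> j") (simp_all add: upper_part_def)
    qed (use int_up second in \<open>auto simp: upper_part_def\<close>)
    moreover have "integral\<^sup>L P (\<lambda>\<omega>. (vnorm N (tvec N (lower_part x) \<omega> u))\<^sup>2)
        \<le> real (Suc K) * (\<Sum>j<N. \<Sum>i<N. (if j < i then 1 else 0) * (cmod (u i))\<^sup>2)"
    proof (rule vnorm_tvec_le)
      fix i k j assume *: "i < N" "k < N" "j < N" "i + K < k \<or> k + K < i"
      \<comment> \<open>A column of \<open>lower_part x\<close> is a row of \<open>x\<close>, hence
        the exchanged indices.\<close>
      then have "idist j i j k > K" by (auto simp: idist_def)
      with * show "integral\<^sup>L P (\<lambda>\<omega>. lower_part x i j \<omega> * lower_part x k j \<omega>) = 0"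
        using uncorr[of j i j k] by (cases "j < i"; cases "j < k") (simp_all add: lower_part_def)
    qed (use int_low second in \<open>auto simp: lower_part_def\<close>)
    ultimately have "integral\<^sup>L P (\<lambda>\<omega>. (vnorm N (tvec N (upper_part x) \<omega> u))\<^sup>2)
        + integral\<^sup>L P (\<lambda>\<omega>. (vnorm N (tvec N (lower_part x) \<omega> u))\<^sup>2)
        \<le> real (Suc K) * (\<Sum>j<N. \<Sum>i<N. (if i \<le> j then 1 else 0) * (cmod (u i))\<^sup>2)
        + real (Suc K) * (\<Sum>j<N. \<Sum>i<N. (if j < i then 1 else 0) * (cmod (u i))\<^sup>2)"
      by (rule add_mono)
    \<comment> \<open>The indicators of the two triangles add up to 1, so treating them separately
      does not double the constant. The remaining sum over j gives a factor N that cancels the 1/N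
      in \<open>Xi\<close>.\<close>
    also have "\<dots> = real (Suc K) * (\<Sum>j<N. \<Sum>i<N. (cmod (u i))\<^sup>2)"
      unfolding distrib_left[symmetric] sum.distrib[symmetric]
      by (intro arg_cong2[where f = "(*)"] sum.cong refl) auto
    also have "\<dots> = real N * (real (Suc K) * (vnorm N u)\<^sup>2)"
      by (simp add: vnorm_sq)
    finally have "1 / real N * (integral\<^sup>L P (\<lambda>\<omega>. (vnorm N (tvec N (upper_part x) \<omega> u))\<^sup>2)
        + integral\<^sup>L P (\<lambda>\<omega>. (vnorm N (tvec N (lower_part x) \<omega> u))\<^sup>2)) \<le> real (Suc K) * (vnorm N u)\<^sup>2"
      using N by (simp add: divide_le_eq mult.commute)
    then show ?thesis
      unfolding sform_Xi Im_of_real_mult plus_complex.sel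
      by (simp only: cov_map_unit int_up int_low)
  qed
  interpret dyson_equation N "Xi P x N" "real (Suc K)" z
  proof
    show "sq_mat N (Xi P x N M)" for M by (auto simp: sq_mat_def Xi_def)
    show "Xi P x N (\<lambda>i j. A i j - B i j) = (\<lambda>i k. Xi P x N A i k - Xi P x N B i k)" for A B
      by (intro ext) (simp add: Xi_def right_diff_distrib sum_subtractf diff_divide_distrib)
    show "(\<lambda>n. Xi P x N (S n) i k) \<longlonglongrightarrow> Xi P x N L i k"
      if "\<And>j l. (\<lambda>n. S n j l) \<longlonglongrightarrow> L j l" for S L i k
      unfolding Xi_def by (cases "i < N \<and> k < N") (auto intro!: tendsto_intros that)
    show "2 * cmod (sform N (Xi P x N X) u v)
        \<le> c * (Im (sform N (Xi P x N A) u u) + Im (sform N (Xi P x N B) v v))"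
      if "\<And>u v. 2 * cmod (sform N X u v) \<le> c * (Im (sform N A u u) + Im (sform N B v v))" for X c A B u v
      by (intro Xi_dominated int_up int_low that)
  qed (use unit_le z in auto)
  \<comment> \<open>Here K >= 1 enters.\<close>
  have "real (Suc K) \<le> 2 * real K" "0 < 2 * real K" using K by auto
  then show ?thesis
    using solution_exists solution_unique solution_bounds unfolding shifted_def by blast
qed

end
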